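(* There exists a torsion free group $G$ acting geometrically on a product of two trees and a subgroup $H\le G$ isomorphic to $\mathbb Z$ such that the commensurator $N_G[H]$ is not finitely generated. Moreover, $N_G[H]$ does not normalize any finite index subgroup of $H$.
   Context: Two subgroups of $G$ are commensurable if their intersection has finite index in both; $N_G[H]=\{g\in G: gHg^{-1}\text{ and }H\text{ are commensurable}\}$. An action is geometric if it is by isometries, proper and cocompact. A product of two trees is given the $\ell^2$ product metric, each tree having edges of length $1$. *)

theory Defs
  imports
    "HOL-Algebra.Group_Action"
    "HOL-Algebra.Elementary_Groups"
    "HOL-Analysis.Abstract_Metric_Spaces"
begin

section \<open>Trees and their geometric realizations\<close>

text \<open>Graphs are simple and undirected, possibly infinite: a vertex set together with a
  symmetric irreflexive set of ordered pairs of vertices.\<close>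

definition has_cycle :: "('v \<times> 'v) set \<Rightarrow> bool" where
  "has_cycle E \<longleftrightarrow> (\<exists>c. distinct c \<and> length c \<ge> 3 \<and>
     (\<forall>i<length c. (c ! i, c ! (Suc i mod length c)) \<in> E))"

definition is_tree :: "'v set \<Rightarrow> ('v \<times> 'v) set \<Rightarrow> bool" where
  "is_tree V E \<longleftrightarrow>
     E \<subseteq> V \<times> V \<and> sym E \<and> irrefl E \<and>
     V \<noteq> {} \<and> (\<forall>u\<in>V. \<forall>v\<in>V. (u, v) \<in> E\<^sup>*) \<and> \<not> has_cycle E"

text \<open>Points of the realization are given by barycentric coordinates with respect to the
  vertices: \<open>edge_point u v t\<close> is the point at distance \<open>t\<close> from \<open>u\<close> on the edge \<open>uv\<close>, so it
  coincides with \<open>edge_point v u (1 - t)\<close>.\<close>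

definition vertex_point :: "'v \<Rightarrow> 'v \<Rightarrow> real" where
  "vertex_point v = indicator {v}"

definition edge_point :: "'v \<Rightarrow> 'v \<Rightarrow> real \<Rightarrow> 'v \<Rightarrow> real" where
  "edge_point u v t = (\<lambda>w. (1 - t) * vertex_point u w + t * vertex_point v w)"

definition realization :: "'v set \<Rightarrow> ('v \<times> 'v) set \<Rightarrow> ('v \<Rightarrow> real) set" where
  "realization V E =
     vertex_point ` V \<union> {edge_point u v t | u v t. (u, v) \<in> E \<and> 0 \<le> t \<and> t \<le> 1}"

text \<open>\<open>pl_path E x y l\<close>: there is a piecewise linear path of length \<open>l\<close> from \<open>x\<close> to \<open>y\<close>, each
  edge having length 1. The metric is the induced path metric.\<close>

inductive pl_path ::
  "('v \<times> 'v) set \<Rightarrow> ('v \<Rightarrow> real) \<Rightarrow> ('v \<Rightarrow> real) \<Rightarrow> real \<Rightarrow> bool" for E x where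
  refl: "pl_path E x x 0"
| step: "pl_path E x (edge_point u v s) l \<Longrightarrow> (u, v) \<in> E \<Longrightarrow> 0 \<le> s \<Longrightarrow> s \<le> 1 \<Longrightarrow>
     0 \<le> t \<Longrightarrow> t \<le> 1 \<Longrightarrow> pl_path E x (edge_point u v t) (l + \<bar>s - t\<bar>)"

definition path_dist :: "('v \<times> 'v) set \<Rightarrow> ('v \<Rightarrow> real) \<Rightarrow> ('v \<Rightarrow> real) \<Rightarrow> real" where
  "path_dist E x y = (if \<exists>l. pl_path E x y l then Inf {l. pl_path E x y l} else 0)"

lemma pl_path_trans:
  assumes "pl_path E y z l'" "pl_path E x y l"
  shows "pl_path E x z (l + l')"
  using assms
proof (induction rule: pl_path.induct)
  case (step u v s l' t)
  then have "pl_path E x (edge_point u v t) ((l + l') + \<bar>s - t\<bar>)"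
    by (intro pl_path.step)
  then show ?case by (simp add: add.assoc)
qed simp

lemma pl_path_sym:
  assumes "pl_path E x y l"
  shows "pl_path E y x l"
  using assms
proof (induction rule: pl_path.induct)
  case refl
  show ?case by (rule pl_path.refl)
next
  case (step u v s l t)
  have "pl_path E (edge_point u v t) (edge_point u v s) (0 + \<bar>t - s\<bar>)"
    using step by (intro pl_path.step pl_path.refl)
  from pl_path_trans[OF step.IH this] show ?case
    by (simp add: abs_minus_commute add.commute)
qed

lemma pl_path_lipschitz:
  assumes "pl_path E x y l"
  shows "\<bar>x w - y w\<bar> \<le> l"
  using assms
proof (induction rule: pl_path.induct)
  case (step u v s l t)
  have "edge_point u v s w - edge_point u v t w = (s - t) * (vertex_point v w - vertex_point u w)"
    by (simp add: edge_point_def algebra_simps)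
  moreover have "\<bar>vertex_point v w - vertex_point u w\<bar> \<le> (1::real)"
    by (auto simp: vertex_point_def indicator_def)
  ultimately have "\<bar>edge_point u v s w - edge_point u v t w\<bar> \<le> \<bar>s - t\<bar>"
    by (simp add: abs_mult mult_left_le)
  with step.IH show ?case by linarith
qed simp

lemma edge_point_0: "edge_point u v 0 = vertex_point u"
  and edge_point_1: "edge_point u v 1 = vertex_point v"
  by (auto simp: edge_point_def)

lemma pl_path_vertices:
  assumes "(u, v) \<in> E\<^sup>*"
  shows "\<exists>l. pl_path E (vertex_point u) (vertex_point v) l"
  using assms
proof (induction rule: rtrancl_induct)
  case base
  show ?case using pl_path.refl by blast
next
  case (step v w)
  then obtain l where "pl_path E (vertex_point u) (edge_point v w 0) l"
    by (auto simp: edge_point_0)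
  from pl_path.step[OF this step(2), of 1] show ?case
    by (auto simp: edge_point_1)
qed

lemma pl_path_exists:
  assumes "is_tree V E" "x \<in> realization V E" "y \<in> realization V E"
  shows "\<exists>l. pl_path E x y l"
proof -
  have near: "\<exists>u\<in>V. \<exists>l. pl_path E (vertex_point u) z l" if "z \<in> realization V E" for z
    using that unfolding realization_def
  proof (elim UnE imageE CollectE exE conjE)
    fix u v t assume h: "z = edge_point u v t" "(u, v) \<in> E" "0 \<le> t" "t \<le> 1"
    have "pl_path E (vertex_point u) (edge_point u v 0) 0"
      by (simp add: edge_point_0 pl_path.refl)
    from pl_path.step[OF this h(2) _ _ h(3,4)]
    have "pl_path E (vertex_point u) z (0 + \<bar>0 - t\<bar>)" by (simp add: h(1))
    moreover have "u \<in> V" using assms(1) h(2) by (auto simp: is_tree_def)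
    ultimately show ?thesis by blast
  qed (use pl_path.refl in blast)
  obtain u v l l' where "u \<in> V" "v \<in> V" "pl_path E (vertex_point u) x l"
    "pl_path E (vertex_point v) y l'"
    using near assms(2,3) by meson
  moreover obtain k where "pl_path E (vertex_point u) (vertex_point v) k"
    using pl_path_vertices assms(1) \<open>u \<in> V\<close> \<open>v \<in> V\<close> unfolding is_tree_def by meson
  ultimately show ?thesis using pl_path_trans pl_path_sym by meson
qed

lemma Metric_space_realization:
  assumes "is_tree V E"
  shows "Metric_space (realization V E) (path_dist E)"
proof
  have nonneg: "0 \<le> l" if "pl_path E x y l" for x y l
    using pl_path_lipschitz[OF that, of undefined] by linarith
  have bdd: "bdd_below {l. pl_path E x y l}" for x y
    by (rule bdd_belowI[of _ 0]) (auto intro: nonneg)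
  have le: "path_dist E x y \<le> l" if "pl_path E x y l" for x y l
    using that bdd[of x y] by (auto simp: path_dist_def intro: cInf_lower)
  have ge: "c \<le> path_dist E x y"
    if "pl_path E x y k" "\<And>l. pl_path E x y l \<Longrightarrow> c \<le> l" for x y c k
    using that by (auto simp: path_dist_def intro!: cInf_greatest)
  show nonneg': "0 \<le> path_dist E x y" for x y
  proof (cases "\<exists>l. pl_path E x y l")
    case True
    then show ?thesis using ge nonneg by meson
  qed (simp add: path_dist_def)
  have "pl_path E x y = pl_path E y x" for x y
    using pl_path_sym by blast
  then show "path_dist E x y = path_dist E y x" for x y
    by (metis path_dist_def)
  show "path_dist E x y = 0 \<longleftrightarrow> x = y"
    if xy: "x \<in> realization V E" "y \<in> realization V E" for x y
  proof
    assume eq: "path_dist E x y = 0"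
    obtain k where k: "pl_path E x y k" using pl_path_exists[OF assms xy] by blast
    have "\<bar>x w - y w\<bar> \<le> path_dist E x y" for w
      by (rule ge[OF k pl_path_lipschitz])
    with eq show "x = y" by (simp add: fun_eq_iff)
  next
    assume "x = y"
    then have "path_dist E x y \<le> 0" using le pl_path.refl by metis
    with nonneg'[of x y] show "path_dist E x y = 0" by simp
  qed
  show "path_dist E x z \<le> path_dist E x y + path_dist E y z"
    if xyz: "x \<in> realization V E" "y \<in> realization V E" "z \<in> realization V E" for x y z
  proof -
    obtain k k' where k: "pl_path E x y k" "pl_path E y z k'"
      using pl_path_exists[OF assms] xyz by meson
    have "path_dist E x z - l \<le> path_dist E y z" if "pl_path E x y l" for l
      by (rule ge[OF k(2)]) (use le[OF pl_path_trans[OF _ that]] in \<open>simp add: algebra_simps\<close>)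
    then have "path_dist E x z - path_dist E y z \<le> path_dist E x y"
      by (intro ge[OF k(1)]) (simp add: algebra_simps)
    then show ?thesis by simp
  qed
qed


section \<open>Geometric actions\<close>

text \<open>Properness is the notion of Bridson and Haefliger: every point has a ball meeting only
  finitely many of its translates.\<close>

definition geometric_action ::
  "('g, 'm) monoid_scheme \<Rightarrow> 'x set \<Rightarrow> ('x \<Rightarrow> 'x \<Rightarrow> real) \<Rightarrow> ('g \<Rightarrow> 'x \<Rightarrow> 'x) \<Rightarrow> bool" where
  "geometric_action G X d \<phi> \<longleftrightarrow>
     Metric_space X d \<and> group_action G X \<phi> \<and>
     (\<forall>g\<in>carrier G. \<forall>x\<in>X. \<forall>y\<in>X. d (\<phi> g x) (\<phi> g y) = d x y) \<and>
     (\<forall>x\<in>X. \<exists>r>0. finite {g \<in> carrier G.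
        \<phi> g ` Metric_space.mball X d x r \<inter> Metric_space.mball X d x r \<noteq> {}}) \<and>
     (\<exists>K. compactin (Metric_space.mtopology X d) K \<and> (\<Union>g\<in>carrier G. \<phi> g ` K) = X)"


section \<open>Subgroups and commensurators\<close>

definition torsion_free :: "('g, 'm) monoid_scheme \<Rightarrow> bool" where
  "torsion_free G \<longleftrightarrow>
     (\<forall>g\<in>carrier G. \<forall>n::nat. n > 0 \<and> g [^]\<^bsub>G\<^esub> n = \<one>\<^bsub>G\<^esub> \<longrightarrow> g = \<one>\<^bsub>G\<^esub>)"

definition fin_gen_subgroup :: "('g, 'm) monoid_scheme \<Rightarrow> 'g set \<Rightarrow> bool" where
  "fin_gen_subgroup G N \<longleftrightarrow> (\<exists>S. finite S \<and> S \<subseteq> N \<and> generate G S = N)"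

definition finite_index_in :: "('g, 'm) monoid_scheme \<Rightarrow> 'g set \<Rightarrow> 'g set \<Rightarrow> bool" where
  "finite_index_in G K H \<longleftrightarrow> finite (rcosets\<^bsub>G\<lparr>carrier := H\<rparr>\<^esub> K)"

definition commensurable :: "('g, 'm) monoid_scheme \<Rightarrow> 'g set \<Rightarrow> 'g set \<Rightarrow> bool" where
  "commensurable G H K \<longleftrightarrow> finite_index_in G (H \<inter> K) H \<and> finite_index_in G (H \<inter> K) K"

definition commensurator :: "('g, 'm) monoid_scheme \<Rightarrow> 'g set \<Rightarrow> 'g set" where
  "commensurator G H =
     {g \<in> carrier G. commensurable G (g <#\<^bsub>G\<^esub> H #>\<^bsub>G\<^esub> inv\<^bsub>G\<^esub> g) H}"

end

theory Submission
  imports Defs "HOL-Computational_Algebra.Polynomial"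
begin

text \<open>Take a one-vertex square complex whose squares are \<open>b a = a' b'\<close>, so that its fundamental group
  \<open>G\<close> consists of the products \<open>\<alpha> \<beta>\<close> of reduced words in the letters \<open>a\<close> and in the letters \<open>b\<close>,
  and acts simply transitively on the vertices of a product of two regular trees. The letters \<open>b\<close>
  form a transducer acting on words in the letters \<open>a\<close>. Let \<open>h\<close> be a letter \<open>b\<close> and let \<open>t\<close> be an
  additional letter \<open>a\<close> commuting with all letters \<open>b\<close>. Some power \<open>h\<^sup>k\<close> with \<open>k > 0\<close> fixes any given
  vertex \<open>x\<close> of the first tree, so \<open>x\<^sup>-\<^sup>1 h\<^sup>k x\<close> is a word in the letters \<open>b\<close> and commutes with \<open>t\<close>: hence
  every conjugate \<open>x t x\<^sup>-\<^sup>1\<close> lies in the commensurator of \<open>\<langle>h\<rangle>\<close>. The exponent sum in the letters \<open>b\<close>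
  is a homomorphism, so the commensurator is the increasing union of the centralizers of the powers
  \<open>h\<^sup>n\<close>. If it were finitely generated or normalized a finite index subgroup of \<open>\<langle>h\<rangle>\<close>, it would
  centralize a single \<open>h\<^sup>n\<close>, and \<open>h\<^sup>n\<close> would fix every vertex without letters \<open>t\<close>. This
  fails when \<open>h\<close> acts with infinite order on such words, as a state of an affine automaton over
  \<open>\<int>/3\<close> does.\<close>

section \<open>Reduced words and transducers\<close>

definition neg :: "'x \<times> bool \<Rightarrow> 'x \<times> bool" where
  "neg a = (fst a, \<not> snd a)"

lemma neg_neg [simp]: "neg (neg a) = a"
  and neg_neq [simp]: "neg a \<noteq> a" "a \<noteq> neg a"
  and neg_inject [simp]: "neg a = neg b \<longleftrightarrow> a = b"
  by (auto simp: neg_def prod_eq_iff)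

abbreviation reduced :: "('x \<times> bool) list \<Rightarrow> bool" where
  "reduced \<equiv> successively (\<lambda>a b. b \<noteq> neg a)"

lemma reduced_ConsD: "reduced (a # w) \<Longrightarrow> reduced w"
  by (auto simp: successively_Cons)

text \<open>Left multiplication by a letter in the free group: in front of a reduced word, only the
  first letter can cancel.\<close>

fun push :: "'x \<times> bool \<Rightarrow> ('x \<times> bool) list \<Rightarrow> ('x \<times> bool) list" where
  "push a [] = [a]"
| "push a (b # w) = (if b = neg a then w else a # b # w)"

lemma push_reduced_Cons: "reduced (a # w) \<Longrightarrow> push a w = a # w"
  by (cases w) auto

lemma reduced_push: "reduced w \<Longrightarrow> reduced (push a w)"
  by (cases w) (auto simp: successively_Cons)

lemma push_neg_push: "reduced w \<Longrightarrow> push (neg a) (push a w) = w"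
  by (cases w) (auto simp: push_reduced_Cons)

text \<open>The exponent sum. It rules out inversions of edges later and, on the second tree,
  supplies a character of the group.\<close>

definition hgt :: "('x \<times> bool) list \<Rightarrow> int" where
  "hgt w = (\<Sum>a\<leftarrow>w. if snd a then 1 else -1)"

lemma hgt_simps [simp]:
  "hgt [] = 0" "hgt (a # w) = (if snd a then 1 else -1) + hgt w" "hgt (u @ w) = hgt u + hgt w"
  by (auto simp: hgt_def)

lemma hgt_push: "hgt (push a w) = (if snd a then 1 else -1) + hgt w"
  by (cases w) (auto simp: neg_def)

text \<open>An edge changes the end of a word, as in the Cayley tree of a free group. Left
  multiplication and the prefix-preserving maps \<open>tr f g s\<close> therefore respect
  adjacency.\<close>

definition adj :: "('x \<times> bool) list \<Rightarrow> ('x \<times> bool) list \<Rightarrow> bool" where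
  "adj u v \<longleftrightarrow> (\<exists>a. v = u @ [a] \<or> u = v @ [a])"

lemma adj_sym: "adj u v \<Longrightarrow> adj v u"
  by (auto simp: adj_def)

lemma adj_push: "adj u v \<Longrightarrow> adj (push c u) (push c v)"
proof -
  have "adj (push c u) (push c (u @ [a]))" for u a
    by (cases u) (auto simp: adj_def)
  then show "adj u v \<Longrightarrow> adj (push c u) (push c v)"
    by (metis adj_def adj_sym)
qed

section \<open>Transducers and systems of squares\<close>

fun tr :: "('s \<Rightarrow> 'l \<Rightarrow> 'l) \<Rightarrow> ('s \<Rightarrow> 'l \<Rightarrow> 's) \<Rightarrow> 's \<Rightarrow> 'l list \<Rightarrow> 'l list" where
  "tr f g s [] = []"
| "tr f g s (a # w) = f s a # tr f g (g s a) w"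

fun st :: "('s \<Rightarrow> 'l \<Rightarrow> 's) \<Rightarrow> 's \<Rightarrow> 'l list \<Rightarrow> 's" where
  "st g s [] = s"
| "st g s (a # w) = st g (g s a) w"

lemma length_tr [simp]: "length (tr f g s w) = length w"
  by (induction w arbitrary: s) auto

lemma tr_append: "tr f g s (u @ v) = tr f g s u @ tr f g (st g s u) v"
  by (induction u arbitrary: s) auto

lemma adj_tr: "adj u v \<Longrightarrow> adj (tr f g s u) (tr f g s v)"
  by (auto simp: adj_def tr_append)

text \<open>The axioms say that the squares \<open>b a = (f b a) (g b a)\<close> are closed under reading them from
  each of their four corners.\<close>

locale squares =
  fixes f :: "'y \<times> bool \<Rightarrow> 'x \<times> bool \<Rightarrow> 'x \<times> bool"
    and g :: "'y \<times> bool \<Rightarrow> 'x \<times> bool \<Rightarrow> 'y \<times> bool"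
  assumes f_neg1: "f (neg b) (f b a) = a"
    and g_neg1: "g (neg b) (f b a) = neg (g b a)"
    and f_neg2: "f (g b a) (neg a) = neg (f b a)"
    and g_neg2: "g (g b a) (neg a) = b"
    and snd_f: "snd (f b a) = snd a"
    and snd_g: "snd (g b a) = snd b"
begin

abbreviation run where "run \<equiv> tr f g"

lemma f_inject [simp]: "f b a = f b a' \<longleftrightarrow> a = a'"
  by (metis f_neg1)

text \<open>By \<open>f_neg2\<close> and injectivity of each \<open>f b\<close>, a cancelling pair
  in the output would come from a cancelling pair in the input.\<close>

lemma reduced_run: "reduced w \<Longrightarrow> reduced (run b w)"
proof (induction w arbitrary: b)
  case (Cons a w)
  then have "reduced (run (g b a) w)" using reduced_ConsD by blast
  moreover have "c \<noteq> neg a" if "w = c # v" for c v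
    using Cons.prems that by auto
  ultimately show ?case
    by (cases w) (auto simp flip: f_neg2)
qed simp

lemma run_neg: "run (neg b) (run b w) = w"
  by (induction w arbitrary: b) (auto simp: f_neg1 g_neg1)

text \<open>This turns the relation \<open>b a = (f b a) (g b a)\<close> into an identity of maps on
  reduced words. In the cancelling case, reading \<open>a\<close> and then \<open>neg a\<close>
  brings the transducer back to state \<open>b\<close>.\<close>

lemma run_push:
  assumes "reduced w"
  shows "run b (push a w) = push (f b a) (run (g b a) w)"
proof (cases w)
  case (Cons c v)
  then show ?thesis
    by (auto simp: f_neg2 g_neg2 simp flip: f_neg2)
qed simp

lemma hgt_run: "hgt (run b w) = hgt w"
  by (induction w arbitrary: b) (auto simp: snd_f)

lemma opposite_corner: "f (neg (g b a)) (neg (f b a)) = neg a" "g (neg (g b a)) (neg (f b a)) = neg b"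
  by (metis f_neg1 f_neg2 g_neg1 g_neg2)+

text \<open>Inverting \<open>b a = a' b'\<close> gives \<open>a^-1 b^-1 = b'^-1 a'^-1\<close>, a
  square with the two alphabets exchanged: the letters \<open>a\<close> become states that act on
  words in the letters \<open>b\<close>.\<close>

lemma dual: "squares (\<lambda>a b. neg (g (neg b) (neg a))) (\<lambda>a b. neg (f (neg b) (neg a)))"
  by unfold_locales
    (use f_neg1 g_neg1 f_neg2 g_neg2 snd_f snd_g neg_neg in \<open>(metis neg_def snd_conv)+\<close>)

end

text \<open>The trees and the group of the theorem live on natural numbers, so reduced words are
  numbered. Over a finite alphabet they form a countably infinite set, and \<open>enc\<close> and
  \<open>dec\<close> are mutually inverse on it.\<close>

definition enc :: "('x::finite \<times> bool) list \<Rightarrow> nat" where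
  "enc = to_nat_on {w. reduced w}"

definition dec :: "nat \<Rightarrow> ('x::finite \<times> bool) list" where
  "dec = from_nat_into {w. reduced w}"

lemma infinite_reduced: "infinite {w :: ('x \<times> bool) list. reduced w}"
proof -
  have "reduced (replicate n (x :: 'x, True))" for x n
    by (induction n) (auto simp: successively_Cons neg_def)
  then have "range (\<lambda>n. replicate n (undefined :: 'x, True)) \<subseteq> {w. reduced w}"
    by auto
  moreover have "inj (\<lambda>n. replicate n (undefined :: 'x, True))"
    by (auto intro: injI)
  ultimately show ?thesis
    using finite_subset range_inj_infinite by metis
qed

lemma countable_reduced: "countable {w :: ('x::finite \<times> bool) list. reduced w}"
  by (rule countable_subset[OF subset_UNIV])
    (metis countableI_type countable_finite countable_lists finite lists_UNIV)

lemma reduced_dec [simp]: "reduced (dec n)"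
proof -
  have "[] \<in> {w :: ('a \<times> bool) list. reduced w}" by simp
  then have "from_nat_into {w :: ('a \<times> bool) list. reduced w} n \<in> {w. reduced w}"
    by (intro from_nat_into) blast
  then show ?thesis by (simp add: dec_def)
qed

lemma dec_enc [simp]: "reduced w \<Longrightarrow> dec (enc w) = w"
  by (simp add: dec_def enc_def countable_reduced)

lemma enc_dec [simp]: "enc (dec n :: ('x::finite \<times> bool) list) = n"
  by (simp add: dec_def enc_def countable_reduced infinite_reduced)

section \<open>Geometric actions from vertex actions\<close>

lemma edge_point_comp:
  assumes "\<And>w. q (p w) = w" "\<And>w. p (q w) = w"
  shows "edge_point u v t \<circ> q = edge_point (p u) (p v) t"
proof -
  have "q w = u \<longleftrightarrow> w = p u" for w u
    using assms by metis
  then have "vertex_point u (q w) = vertex_point (p u) w" for u w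
    by (simp add: vertex_point_def indicator_def)
  then show ?thesis by (simp add: edge_point_def fun_eq_iff)
qed

lemma pl_path_comp:
  assumes "pl_path E x y l"
    and "\<And>w. q (p w) = w" "\<And>w. p (q w) = w" "\<And>u v. (u, v) \<in> E \<Longrightarrow> (p u, p v) \<in> E"
  shows "pl_path E (x \<circ> q) (y \<circ> q) l"
  using assms(1)
proof (induction rule: pl_path.induct)
  case (step u v s l t)
  then show ?case
    using pl_path.step[of E "x \<circ> q" "p u" "p v" s l t] assms(2-4)
    by (simp add: edge_point_comp[of q p] del: o_apply)
qed (rule pl_path.refl)

lemma path_dist_le:
  assumes "pl_path E x y l"
  shows "path_dist E x y \<le> l"
proof -
  have "0 \<le> l" if "pl_path E x y l" for l
    using pl_path_lipschitz[OF that, of undefined] by linarith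
  then have "bdd_below {l. pl_path E x y l}"
    by (intro bdd_belowI[of _ 0]) auto
  then show ?thesis
    using assms by (auto simp: path_dist_def intro: cInf_lower)
qed

lemma path_dist_lipschitz:
  assumes "is_tree V E" "x \<in> realization V E" "y \<in> realization V E"
  shows "\<bar>x w - y w\<bar> \<le> path_dist E x y"
proof -
  obtain l where l: "pl_path E x y l" using pl_path_exists[OF assms] by blast
  then have "\<bar>x w - y w\<bar> \<le> Inf {l. pl_path E x y l}"
    by (intro cInf_greatest) (auto intro: pl_path_lipschitz)
  moreover have "path_dist E x y = Inf {l. pl_path E x y l}"
    unfolding path_dist_def using l by meson
  ultimately show ?thesis by simp
qed

text \<open>Without isolated vertices, a vertex is an endpoint of some edge, so a single case covers
  all points.\<close>

lemma realization_cases: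
  assumes "x \<in> realization V E" "\<And>v. v \<in> V \<Longrightarrow> \<exists>w. (v, w) \<in> E"
  obtains u v t where "(u, v) \<in> E" "t \<in> {0..1}" "x = edge_point u v t"
proof (cases "x \<in> vertex_point ` V")
  case True
  then obtain v where v: "v \<in> V" "x = edge_point v w 0" for w
    by (auto simp: edge_point_0)
  obtain w where "(v, w) \<in> E" using assms(2)[OF v(1)] by blast
  then show ?thesis using v(2)[of w] by (intro that[of v w 0]) auto
next
  case False
  then have "\<exists>u v t. (u, v) \<in> E \<and> t \<in> {0..1} \<and> x = edge_point u v t"
    using assms(1) unfolding realization_def by fastforce
  then show ?thesis using that by blast
qed

lemma edge_point_realization:
  "(u, v) \<in> E \<Longrightarrow> t \<in> {0..1} \<Longrightarrow> edge_point u v t \<in> realization V E"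
  unfolding realization_def by auto

text \<open>The closed star of \<open>u\<close>. A product of two stars will be the compact set
  whose translates cover the product of the trees.\<close>

definition star :: "('v \<times> 'v) set \<Rightarrow> 'v \<Rightarrow> ('v \<Rightarrow> real) set" where
  "star E u = (\<Union>v\<in>E `` {u}. edge_point u v ` {0..1})"

lemma starI: "(u, v) \<in> E \<Longrightarrow> t \<in> {0..1} \<Longrightarrow> edge_point u v t \<in> star E u"
  unfolding star_def by blast

lemma starE:
  assumes "x \<in> star E u"
  obtains v t where "(u, v) \<in> E" "t \<in> {0..1}" "x = edge_point u v t"
  using assms unfolding star_def by blast

text \<open>A star is a finite union of images of the unit interval under the 1-Lipschitz maps
  \<open>edge_point u v\<close>.\<close>

lemma compactin_star:
  assumes "is_tree V E" "finite (E `` {u})"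
  shows "compactin (Metric_space.mtopology (realization V E) (path_dist E)) (star E u)"
proof -
  interpret Metric_space "realization V E" "path_dist E"
    by (rule Metric_space_realization[OF assms(1)])
  have "compactin mtopology (edge_point u v ` {0..1})" if uv: "(u, v) \<in> E" for v
  proof (rule image_compactin)
    show "compactin (top_of_set {0..1::real}) {0..1}"
      by (simp add: compactin_subtopology)
    show "continuous_map (top_of_set {0..1}) mtopology (edge_point u v)"
      unfolding continuous_map_to_metric
    proof (intro ballI allI impI)
      fix s \<epsilon> :: real assume s: "s \<in> topspace (top_of_set {0..1})" and "\<epsilon> > 0"
      have "path_dist E (edge_point u v s) (edge_point u v t) \<le> \<bar>s - t\<bar>" if "t \<in> {0..1}" for t
        using path_dist_le[OF pl_path.step[OF pl_path.refl uv, of s t]] s that by simp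
      then have "edge_point u v t \<in> mball (edge_point u v s) \<epsilon>" if "t \<in> {0..1} \<inter> ball s \<epsilon>" for t
        using that s uv by (fastforce simp: edge_point_realization dist_real_def)
      moreover have "openin (top_of_set {0..1}) ({0..1} \<inter> ball s \<epsilon>)"
        by (simp add: openin_open_Int)
      ultimately show "\<exists>U. openin (top_of_set {0..1}) U \<and> s \<in> U \<and>
          (\<forall>t\<in>U. edge_point u v t \<in> mball (edge_point u v s) \<epsilon>)"
        using s \<open>\<epsilon> > 0\<close> by (intro exI[of _ "{0..1} \<inter> ball s \<epsilon>"]) auto
    qed
  qed
  then show ?thesis
    unfolding star_def using assms(2) by (intro compactin_Union) auto
qed

section \<open>Isometric action on the realization of one tree\<close>

locale tree_action = group G for G (structure) +
  fixes \<rho> :: "'a \<Rightarrow> 'v \<Rightarrow> 'v" and E :: "('v \<times> 'v) set"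
  assumes tree: "is_tree UNIV E"
    and act_mult: "g \<in> carrier G \<Longrightarrow> h \<in> carrier G \<Longrightarrow> \<rho> (g \<otimes> h) p = \<rho> g (\<rho> h p)"
    and act_one: "\<rho> \<one> p = p"
    and act_edge: "g \<in> carrier G \<Longrightarrow> (u, v) \<in> E \<Longrightarrow> (\<rho> g u, \<rho> g v) \<in> E"
    and neighbour: "\<exists>v. (u, v) \<in> E"
    and locally_finite: "finite (E `` {u})"
begin

lemma act_inv:
  assumes "g \<in> carrier G"
  shows "\<rho> (inv g) (\<rho> g p) = p" "\<rho> g (\<rho> (inv g) p) = p"
  using assms by (metis act_mult act_one inv_closed l_inv r_inv)+

text \<open>A point is a function giving barycentric coordinates, so moving it by \<open>g\<close>
  means precomposing with the inverse of \<open>g\<close>.\<close>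

definition T :: "'a \<Rightarrow> ('v \<Rightarrow> real) \<Rightarrow> 'v \<Rightarrow> real" where
  "T g x = x \<circ> \<rho> (inv g)"

lemma T_edge_point: "g \<in> carrier G \<Longrightarrow> T g (edge_point u v t) = edge_point (\<rho> g u) (\<rho> g v) t"
  unfolding T_def by (rule edge_point_comp) (auto simp: act_inv)

lemma T_realization:
  assumes "g \<in> carrier G" "x \<in> realization UNIV E"
  shows "T g x \<in> realization UNIV E"
  using assms(2) neighbour
  by (rule realization_cases) (simp add: T_edge_point edge_point_realization act_edge assms(1))

lemma T_star: "g \<in> carrier G \<Longrightarrow> x \<in> star E u \<Longrightarrow> T g x \<in> star E (\<rho> g u)"
  by (elim starE) (simp add: T_edge_point starI act_edge del: atLeastAtMost_iff)

lemma realization_star: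
  assumes "x \<in> realization UNIV E"
  obtains u where "x \<in> star E u"
  using assms neighbour
proof (rule realization_cases)
  fix u v t assume "(u, v) \<in> E" "t \<in> {0..1}" "x = edge_point u v t"
  then have "x \<in> star E u" by (simp only: starI)
  then show thesis by (rule that)
qed

lemma T_mult: "g \<in> carrier G \<Longrightarrow> h \<in> carrier G \<Longrightarrow> T (g \<otimes> h) x = T g (T h x)"
  by (simp add: T_def fun_eq_iff inv_mult_group act_mult)

lemma T_one: "T \<one> x = x"
  by (simp add: T_def fun_eq_iff act_one)

lemma T_inv:
  assumes "g \<in> carrier G"
  shows "T (inv g) (T g x) = x" "T g (T (inv g) x) = x"
  using assms by (metis T_mult T_one inv_closed l_inv r_inv)+

lemma T_path_dist:
  assumes "g \<in> carrier G"
  shows "path_dist E (T g x) (T g y) = path_dist E x y"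
proof -
  have *: "pl_path E (T h x) (T h y) l" if "pl_path E x y l" "h \<in> carrier G" for h x y l
    unfolding T_def using that(1)
    by (rule pl_path_comp[where p = "\<rho> h"]) (auto simp: act_inv that act_edge)
  have "pl_path E (T g x) (T g y) = pl_path E x y"
    using *[OF _ assms] *[OF _ inv_closed[OF assms], of "T g x" "T g y"] T_inv[OF assms]
    by auto
  then show ?thesis by (simp add: path_dist_def)
qed

text \<open>One coordinate of \<open>x\<close> is at least 1/2, and coordinates are 1-Lipschitz. If
  \<open>x\<close> moves by less than 1/2, the same coordinate of \<open>T g x\<close> is still
  nonzero, so \<open>g\<close> carries some vertex of the support of \<open>x\<close> to another one
  or itself.\<close>

lemma displacement:
  assumes g: "g \<in> carrier G" and x: "x \<in> realization UNIV E"
    and lt: "path_dist E x (T g x) < 1/2"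
  shows "\<exists>u v. x u \<noteq> 0 \<and> x v \<noteq> 0 \<and> \<rho> g u = v"
proof -
  obtain u v t where uv: "(u, v) \<in> E" "t \<in> {0..1}" "x = edge_point u v t"
    using x neighbour by (rule realization_cases)
  have "u \<noteq> v" using tree uv(1) by (auto simp: is_tree_def irrefl_def)
  then have "x u = 1 - t" "x v = t"
    using uv by (auto simp: edge_point_def vertex_point_def)
  then have "x u \<ge> 1/2 \<or> x v \<ge> 1/2" by linarith
  then obtain w where w: "x w \<ge> 1/2" by blast
  have "\<bar>x w - T g x w\<bar> < 1/2"
    using path_dist_lipschitz[OF tree x T_realization[OF g x], of w] lt by linarith
  then have "x (\<rho> (inv g) w) \<noteq> 0" using w by (auto simp: T_def)
  moreover have "x w \<noteq> 0" using w by auto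
  ultimately show ?thesis using act_inv(2)[OF g] by blast
qed

lemma finite_support:
  assumes "x \<in> realization UNIV E"
  shows "finite {u. x u \<noteq> 0}"
  using assms neighbour
proof (rule realization_cases)
  fix u v t assume "x = edge_point u v t"
  then have "{w. x w \<noteq> 0} \<subseteq> {u, v}"
    by (auto simp: edge_point_def vertex_point_def indicator_def split: if_splits)
  then show ?thesis by (rule finite_subset) simp
qed

end

section \<open>Simply transitive actions on pairs of vertices are geometric\<close>

locale two_tree_action =
  A: tree_action G \<rho>1 E1 + B: tree_action G \<rho>2 E2 for G (structure) and \<rho>1 :: "'a \<Rightarrow> 'v \<Rightarrow> 'v"
    and E1 and \<rho>2 :: "'a \<Rightarrow> 'w \<Rightarrow> 'w" and E2 +
  assumes transitive: "\<exists>g\<in>carrier G. \<rho>1 g p = p' \<and> \<rho>2 g q = q'"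
    and free: "g \<in> carrier G \<Longrightarrow> h \<in> carrier G \<Longrightarrow> \<rho>1 g p = \<rho>1 h p \<Longrightarrow> \<rho>2 g q = \<rho>2 h q \<Longrightarrow> g = h"
begin

abbreviation "X1 \<equiv> realization UNIV E1"
abbreviation "X2 \<equiv> realization UNIV E2"
abbreviation "d \<equiv> prod_dist (path_dist E1) (path_dist E2)"

text \<open>The restriction to the product makes \<open>\<Phi> g\<close> extensional, as membership
  in \<open>Bij\<close> demands.\<close>

definition \<Phi> :: "'a \<Rightarrow> ('v \<Rightarrow> real) \<times> ('w \<Rightarrow> real) \<Rightarrow> ('v \<Rightarrow> real) \<times> ('w \<Rightarrow> real)" where
  "\<Phi> g = (\<lambda>z\<in>X1 \<times> X2. (A.T g (fst z), B.T g (snd z)))"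

lemma Phi_apply: "x \<in> X1 \<Longrightarrow> y \<in> X2 \<Longrightarrow> \<Phi> g (x, y) = (A.T g x, B.T g y)"
  by (simp add: \<Phi>_def)

sublocale Metric_space12 X1 "path_dist E1" X2 "path_dist E2"
  by (simp add: Metric_space12_def Metric_space_realization A.tree B.tree)

lemma Phi_Bij:
  assumes "g \<in> carrier G"
  shows "\<Phi> g \<in> Bij (X1 \<times> X2)"
proof -
  have "bij_betw (\<Phi> g) (X1 \<times> X2) (X1 \<times> X2)"
    by (rule bij_betw_byWitness[where f' = "\<Phi> (inv g)"])
      (auto simp: Phi_apply assms A.T_realization B.T_realization A.T_inv B.T_inv)
  then show ?thesis by (simp add: Bij_def \<Phi>_def)
qed

lemma group_action_Phi: "group_action G (X1 \<times> X2) \<Phi>"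
  unfolding group_action_def group_hom_def group_hom_axioms_def
proof (intro conjI homI)
  show "group (BijGroup (X1 \<times> X2))" by (rule group_BijGroup)
  show "\<Phi> g \<in> carrier (BijGroup (X1 \<times> X2))" if "g \<in> carrier G" for g
    using Phi_Bij[OF that] by (simp add: BijGroup_def)
  show "\<Phi> (g \<otimes> h) = \<Phi> g \<otimes>\<^bsub>BijGroup (X1 \<times> X2)\<^esub> \<Phi> h" if gh: "g \<in> carrier G" "h \<in> carrier G" for g h
  proof -
    have "\<Phi> (g \<otimes> h) = compose (X1 \<times> X2) (\<Phi> g) (\<Phi> h)"
      using gh by (auto simp: fun_eq_iff compose_def \<Phi>_def A.T_mult B.T_mult A.T_realization B.T_realization)
    then show ?thesis using gh Phi_Bij by (simp add: BijGroup_def)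
  qed
qed (rule A.is_group)

text \<open>If \<open>g\<close> moves a point of the ball of radius 1/4 into that ball, both
  coordinates of the centre move by less than 1/2. By \<open>displacement\<close>, \<open>g\<close>
  then matches support vertices in each tree. There are finitely many such choices, and by freeness
  each one determines at most one \<open>g\<close>.\<close>

lemma Phi_proper:
  assumes z: "z \<in> X1 \<times> X2"
  shows "finite {g \<in> carrier G. \<Phi> g ` Prod_metric.mball z (1/4) \<inter> Prod_metric.mball z (1/4) \<noteq> {}}"
proof -
  obtain x y where xy: "z = (x, y)" "x \<in> X1" "y \<in> X2" using z by auto
  let ?S = "{u. x u \<noteq> 0} \<times> {u. x u \<noteq> 0} \<times> {u. y u \<noteq> 0} \<times> {u. y u \<noteq> 0}"
  let ?F = "\<lambda>(u, u', v, v'). {g \<in> carrier G. \<rho>1 g u = u' \<and> \<rho>2 g v = v'}"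
  have "finite (?F s)" for s
  proof (cases s)
    case (fields u u' v v')
    have "g = h" if "g \<in> ?F s" "h \<in> ?F s" for g h
      using that free[of g h u v] unfolding fields by simp
    then have "?F s \<subseteq> {g}" if "g \<in> ?F s" for g
      using that by blast
    moreover have "finite (?F s)" if "?F s \<subseteq> {g}" for g
      using that by (rule finite_subset) simp
    moreover have "finite (?F s)" if "\<nexists>g. g \<in> ?F s"
    proof -
      have "?F s = {}" using that by blast
      then show ?thesis by (simp only: finite.emptyI)
    qed
    ultimately show ?thesis by blast
  qed
  moreover have "finite ?S"
    using xy A.finite_support B.finite_support by (intro finite_cartesian_product) auto
  ultimately have fin: "finite (\<Union>s\<in>?S. ?F s)" by blast
  have "g \<in> (\<Union>s\<in>?S. ?F s)"
    if g: "g \<in> carrier G" and ne: "\<Phi> g ` Prod_metric.mball z (1/4) \<inter> Prod_metric.mball z (1/4) \<noteq> {}" for g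
  proof -
    obtain w where "w \<in> Prod_metric.mball z (1/4)" "\<Phi> g w \<in> Prod_metric.mball z (1/4)"
      using ne by blast
    then obtain x' y' where b: "(x', y') \<in> Prod_metric.mball z (1/4)"
      "\<Phi> g (x', y') \<in> Prod_metric.mball z (1/4)"
      by (cases w) blast
    then have in': "x' \<in> X1" "y' \<in> X2" by auto
    note gin = A.T_realization[OF g in'(1)] B.T_realization[OF g in'(2)]
      A.T_realization[OF g xy(2)] B.T_realization[OF g xy(3)]
    have *: "d (x, y) (x', y') < 1/4" "d (x, y) (A.T g x', B.T g y') < 1/4"
      using b in' by (auto simp: xy Phi_apply)
    have 1: "path_dist E1 x x' < 1/4" "path_dist E1 x (A.T g x') < 1/4"
      "path_dist E2 y y' < 1/4" "path_dist E2 y (B.T g y') < 1/4"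
      using * by (meson component_le_prod_metric order.strict_trans1)+
    have "path_dist E1 x (A.T g x) \<le> path_dist E1 x (A.T g x') + path_dist E1 (A.T g x') (A.T g x)"
      "path_dist E2 y (B.T g y) \<le> path_dist E2 y (B.T g y') + path_dist E2 (B.T g y') (B.T g y)"
      using M1.triangle M2.triangle xy gin by blast+
    then have "path_dist E1 x (A.T g x) < 1/2" "path_dist E2 y (B.T g y) < 1/2"
      using 1 g by (simp_all add: A.T_path_dist B.T_path_dist M1.commute[of x' x] M2.commute[of y' y])
    then obtain u u' v v' where "x u \<noteq> 0" "x u' \<noteq> 0" "\<rho>1 g u = u'" "y v \<noteq> 0" "y v' \<noteq> 0" "\<rho>2 g v = v'"
      using A.displacement[OF g xy(2)] B.displacement[OF g xy(3)] by blast
    then show ?thesis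
      using g by (intro UN_I[of "(u, u', v, v')"]) auto
  qed
  then show ?thesis by (intro finite_subset[OF _ fin]) blast
qed

text \<open>Every point lies in a product of two stars, and transitivity on pairs of vertices
  carries that product into a fixed one.\<close>

lemma Phi_cocompact:
  "\<exists>K. compactin Prod_metric.mtopology K \<and> (\<Union>g\<in>carrier G. \<Phi> g ` K) = X1 \<times> X2"
proof -
  fix p q
  let ?K = "star E1 p \<times> star E2 q"
  have c1: "compactin M1.mtopology (star E1 p)" and c2: "compactin M2.mtopology (star E2 q)"
    by (simp_all add: compactin_star A.tree B.tree A.locally_finite B.locally_finite)
  then have "compactin Prod_metric.mtopology ?K"
    by (simp add: mtopology_prod_metric compactin_Times)
  moreover have sub: "?K \<subseteq> X1 \<times> X2"
    using compactin_subset_topspace[OF c1] compactin_subset_topspace[OF c2] by auto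
  have "(\<Union>g\<in>carrier G. \<Phi> g ` ?K) = X1 \<times> X2"
  proof (intro equalityI subsetI)
    fix z assume "z \<in> (\<Union>g\<in>carrier G. \<Phi> g ` ?K)"
    then show "z \<in> X1 \<times> X2"
      using sub Phi_Bij by (auto simp: Phi_apply A.T_realization B.T_realization subset_iff)
  next
    fix z assume "z \<in> X1 \<times> X2"
    then obtain x y where z: "z = (x, y)" "x \<in> X1" "y \<in> X2" by auto
    obtain u where u: "x \<in> star E1 u" using z(2) by (rule A.realization_star)
    obtain v where v: "y \<in> star E2 v" using z(3) by (rule B.realization_star)
    obtain g where g: "g \<in> carrier G" "\<rho>1 g u = p" "\<rho>2 g v = q" using transitive by blast
    have k: "(A.T g x, B.T g y) \<in> ?K"
      using A.T_star[OF g(1) u] B.T_star[OF g(1) v] g by simp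
    have "\<Phi> (inv g) (A.T g x, B.T g y) = z"
      using z g by (simp add: Phi_apply A.T_realization B.T_realization A.T_inv B.T_inv)
    then have "z \<in> \<Phi> (inv g) ` ?K"
      using k by (metis image_eqI)
    then show "z \<in> (\<Union>g\<in>carrier G. \<Phi> g ` ?K)"
      using A.inv_closed[OF g(1)] by (rule UN_I[rotated])
  qed
  ultimately show ?thesis by blast
qed

theorem geometric: "geometric_action G (X1 \<times> X2) d \<Phi>"
  unfolding geometric_action_def
proof (intro conjI ballI)
  show "d (\<Phi> g z) (\<Phi> g z') = d z z'" if "g \<in> carrier G" "z \<in> X1 \<times> X2" "z' \<in> X1 \<times> X2" for g z z'
    using that by (auto simp: Phi_apply prod_dist_def A.T_path_dist B.T_path_dist)
  show "\<exists>r>0. finite {g \<in> carrier G. \<Phi> g ` Prod_metric.mball z r \<inter> Prod_metric.mball z r \<noteq> {}}"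
    if "z \<in> X1 \<times> X2" for z
    using Phi_proper[OF that] by (intro exI[of _ "1/4"]) simp
qed (rule prod_metric group_action_Phi Phi_cocompact)+

end

section \<open>The tree of reduced words\<close>

text \<open>The vertices are codes and do not reveal the alphabet, so a type argument records
  it.\<close>

definition wtree :: "'x::finite itself \<Rightarrow> (nat \<times> nat) set" where
  "wtree _ = {(p, q). adj (dec p :: ('x \<times> bool) list) (dec q)}"

lemma enc_eq_root:
  fixes w :: "('x::finite \<times> bool) list"
  assumes "reduced w" "enc w = enc ([] :: ('x \<times> bool) list)"
  shows "w = []"
proof -
  have "dec (enc w) = w" "dec (enc ([] :: ('x \<times> bool) list)) = ([] :: ('x \<times> bool) list)" using assms(1) by simp_all
  then show ?thesis using assms(2) by simp
qed

abbreviation wroot :: "'x::finite itself \<Rightarrow> nat" where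
  "wroot _ \<equiv> enc ([] :: ('x \<times> bool) list)"

lemma adj_butlast: "adj u v \<Longrightarrow> length v \<le> length u \<Longrightarrow> v = butlast u"
  by (auto simp: adj_def)

lemma dec_inject: "(dec p :: ('x::finite \<times> bool) list) = dec q \<longleftrightarrow> p = q"
  by (metis enc_dec)

text \<open>A neighbour that is not longer must arise by removing the last letter, so it is the
  parent.\<close>

lemma wtree_parent:
  fixes t :: "'x::finite itself"
  assumes "(p, q) \<in> wtree t" "(p, q') \<in> wtree t"
    and "length (dec q :: ('x \<times> bool) list) \<le> length (dec p :: ('x \<times> bool) list)"
    and "length (dec q' :: ('x \<times> bool) list) \<le> length (dec p :: ('x \<times> bool) list)"
  shows "q = q'"
proof -
  have "(dec q :: ('x \<times> bool) list) = dec q'"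
    using assms adj_butlast by (metis (mono_tags) case_prodD mem_Collect_eq wtree_def)
  then show ?thesis by (simp add: dec_inject)
qed

lemma sym_wtree: "sym (wtree t)"
  by (auto simp: wtree_def sym_def adj_sym)

text \<open>At a deepest vertex of a cycle, both neighbours on the cycle would be its
  parent.\<close>

lemma no_cycle_wtree: "\<not> has_cycle (wtree (t :: 'x::finite itself))"
proof
  assume "has_cycle (wtree t)"
  then obtain c where c: "distinct c" "length c \<ge> 3"
    and edge: "\<And>i. i < length c \<Longrightarrow> (c ! i, c ! (Suc i mod length c)) \<in> wtree t"
    unfolding has_cycle_def by blast
  define n where "n = length c"
  define depth where "depth = (\<lambda>p. length (dec p :: ('x \<times> bool) list))"
  have "finite (set c)" "set c \<noteq> {}" using c(2) by auto
  then obtain p where p: "p \<in> set c" "\<And>q. q \<in> set c \<Longrightarrow> depth q \<le> depth p"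
    using finite_imageI[of "set c" depth] Max_in[of "depth ` set c"] Max_ge[of "depth ` set c"]
    by (metis (no_types, lifting) imageE image_eqI image_is_empty)
  then obtain i where i: "i < n" "p = c ! i" by (metis in_set_conv_nth n_def)
  define j k where "j = Suc i mod n" and "k = (if i = 0 then n - 1 else i - 1)"
  \<comment> \<open>The length being at least 3 keeps the successor index \<open>j\<close> and the
    predecessor index \<open>k\<close> apart.\<close>
  have jk: "j < n" "k < n" "Suc k mod n = i" "j \<noteq> k"
    using i(1) c(2) by (auto simp: j_def k_def n_def mod_Suc split: if_splits)
  have "(c ! i, c ! j) \<in> wtree t"
    using edge[of i] i by (simp add: j_def n_def)
  moreover have "(c ! i, c ! k) \<in> wtree t"
    using edge[of k] jk symD[OF sym_wtree] by (simp add: n_def)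
  moreover have "depth (c ! j) \<le> depth (c ! i)" "depth (c ! k) \<le> depth (c ! i)"
    using p(2) i(2) jk by (auto simp: n_def)
  ultimately have "c ! j = c ! k"
    unfolding depth_def by (rule wtree_parent)
  then show False
    using c(1) jk by (simp add: nth_eq_iff_index_eq n_def)
qed

lemma wtree_connected: "(p, q) \<in> (wtree (t :: 'x::finite itself))\<^sup>*"
proof -
  have "reduced w \<Longrightarrow> (enc ([] :: ('x \<times> bool) list), enc w) \<in> (wtree t)\<^sup>*" for w :: "('x \<times> bool) list"
  proof (induction w rule: rev_induct)
    case (snoc a w)
    then have "reduced w" by (simp add: successively_append_iff)
    then have "(enc w, enc (w @ [a])) \<in> wtree t"
      using snoc.prems by (auto simp: wtree_def adj_def)
    with snoc.IH[OF \<open>reduced w\<close>] show ?case by simp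
  qed simp
  then have root: "(enc ([] :: ('x \<times> bool) list), p) \<in> (wtree t)\<^sup>*" for p
    by (metis enc_dec reduced_dec)
  have "sym ((wtree t)\<^sup>*)" by (rule sym_rtrancl[OF sym_wtree])
  then show ?thesis
    using root rtrancl_trans symD by metis
qed

lemma is_tree_wtree: "is_tree UNIV (wtree t)"
  unfolding is_tree_def
  using sym_wtree no_cycle_wtree wtree_connected
  by (auto simp: irrefl_def) (auto simp: wtree_def adj_def)

lemma wtree_neighbour: "\<exists>q. (p, q) \<in> wtree (t :: 'x::finite itself)"
proof (cases "dec p :: ('x \<times> bool) list" rule: rev_cases)
  case Nil
  then have "(p, enc [(undefined :: 'x, True)]) \<in> wtree t"
    by (auto simp: wtree_def adj_def)
  then show ?thesis by blast
next
  case (snoc w a)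
  then have "reduced w" using reduced_dec[of p] by (metis successively_append_iff)
  then have "(p, enc w) \<in> wtree t"
    using snoc by (simp add: wtree_def adj_def)
  then show ?thesis by blast
qed

lemma wtree_locally_finite: "finite (wtree (t :: 'x::finite itself) `` {p})"
proof (rule finite_subset)
  let ?w = "dec p :: ('x \<times> bool) list"
  show "wtree t `` {p} \<subseteq> enc ` insert (butlast ?w) (range (\<lambda>a. ?w @ [a]))"
  proof
    fix q assume "q \<in> wtree t `` {p}"
    then have "(dec q :: ('x \<times> bool) list) \<in> insert (butlast ?w) (range (\<lambda>a. ?w @ [a]))"
      by (auto simp: wtree_def adj_def)
    then show "q \<in> enc ` insert (butlast ?w) (range (\<lambda>a. ?w @ [a]))"
      by (metis enc_dec image_eqI)
  qed
qed simp

text \<open>A walk from \<open>p\<close> to \<open>h p\<close> of minimal length, over all \<open>p\<close>, extends periodically to a walk without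
  backtracking. If \<open>h\<close> has finite order, this walk has a vertex of maximal depth, whose two neighbours
  on the walk must both be its parent. Heights exclude inversions.\<close>

lemma fixed_vertex:
  fixes t :: "'x::finite itself"
  assumes edge: "\<And>p q. (p, q) \<in> wtree t \<Longrightarrow> (h p, h q) \<in> wtree t"
    and hgt: "\<And>p. hgt (dec (h p) :: ('x \<times> bool) list) = hgt (dec p :: ('x \<times> bool) list) + c"
    and order: "\<And>p. (h ^^ n) p = p" "n > 0"
  shows "\<exists>p. h p = p"
proof (rule ccontr)
  assume nofix: "\<nexists>p. h p = p"
  let ?E = "wtree t"
  define depth where "depth = (\<lambda>p. length (dec p :: ('x \<times> bool) list))"
  have "hgt (dec ((h ^^ k) p) :: ('x \<times> bool) list) = hgt (dec p :: ('x \<times> bool) list) + int k * c" for k p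
    by (induction k) (auto simp: hgt algebra_simps)
  \<comment> \<open>After \<open>n\<close> steps the height is back where it started, so
    \<open>n c = 0\<close>.\<close>
  from this[of n] order have c: "c = 0" by simp
  define m where "m = (LEAST m. \<exists>p. (p, h p) \<in> ?E ^^ m)"
  have ex: "\<exists>m p. (p, h p) \<in> ?E ^^ m"
    using wtree_connected rtrancl_imp_relpow by metis
  have "\<exists>p. (p, h p) \<in> ?E ^^ m"
    unfolding m_def using LeastI_ex[OF ex] .
  then obtain p where "(p, h p) \<in> ?E ^^ m" by blast
  then obtain w where w: "w 0 = p" "w m = h p" "\<And>i. i < m \<Longrightarrow> (w i, w (Suc i)) \<in> ?E"
    by (auto simp: relpow_fun_conv)
  have minimal: "m \<le> k" if "(q, h q) \<in> ?E ^^ k" for k q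
    unfolding m_def using that by (intro Least_le) blast
  have "m \<noteq> 0" using w nofix by (metis)
  moreover have "m \<noteq> 1"
  proof
    assume "m = 1"
    then have "(p, h p) \<in> ?E" using w(1,2) w(3)[of 0] by simp
    then show False using hgt[of p] c by (auto simp: wtree_def adj_def split: if_splits)
  qed
  ultimately have m: "m \<ge> 2" by simp
  \<comment> \<open>The translates of the minimal walk \<open>w\<close> under powers of
    \<open>h\<close>, joined end to end.\<close>
  define q where "q = (\<lambda>i. (h ^^ (i div m)) (w (i mod m)))"
  have q_shift: "q (i + m) = h (q i)" for i
    using m by (simp add: q_def)
  have "(u, v) \<in> ?E \<Longrightarrow> ((h ^^ k) u, (h ^^ k) v) \<in> ?E" for k u v
    by (induction k) (auto intro: edge)
  moreover have "q (Suc i) = (h ^^ (i div m)) (w (Suc (i mod m)))" for i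
    using w(1,2) m by (auto simp: q_def mod_Suc div_Suc funpow_swap1)
  ultimately have q_edge: "(q i, q (Suc i)) \<in> ?E" for i
    using w(3)[of "i mod m"] m by (simp add: q_def)
  have q_walk: "(q i, q (i + k)) \<in> ?E ^^ k" for i k
    by (induction k) (use q_edge in auto)
  \<comment> \<open>A backtrack could be skipped: the rest of the walk would join \<open>q i\<close>
    to \<open>h (q i)\<close> in \<open>m - 2\<close> steps, against minimality.\<close>
  have q_turn: "q (Suc (Suc i)) \<noteq> q i" for i
  proof
    assume "q (Suc (Suc i)) = q i"
    moreover have "Suc (Suc i) + (m - 2) = i + m" using m by simp
    ultimately have "(q i, h (q i)) \<in> ?E ^^ (m - 2)"
      using q_walk[of "Suc (Suc i)" "m - 2"] q_shift[of i] by metis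
    then show False using minimal m by fastforce
  qed
  have "q (i + k * m) = (h ^^ k) (q i)" for i k
  proof (induction k)
    case (Suc k)
    have "i + Suc k * m = (i + k * m) + m" by simp
    then have "q (i + Suc k * m) = h (q (i + k * m))" using q_shift by metis
    then show ?case using Suc by simp
  qed simp
  then have period: "q (i + n * m) = q i" for i
    by (simp add: order)
  have "q (i + k * (n * m)) = q i" for i k
  proof (induction k)
    case (Suc k)
    have "i + Suc k * (n * m) = (i + k * (n * m)) + n * m" by simp
    then show ?case using period[of "i + k * (n * m)"] Suc by metis
  qed simp
  then have q_mod: "q (i mod (n * m)) = q i" for i
    by (metis add.commute div_mult_mod_eq)
  have pos: "n * m > 0" using order(2) m by simp
  let ?D = "(\<lambda>i. depth (q i)) ` {..<n * m}"
  have "Max ?D \<in> ?D" using pos by (intro Max_in) (auto simp: lessThan_empty_iff)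
  then obtain i where i: "depth (q i) = Max ?D" by auto
  have max: "depth (q j) \<le> depth (q i)" for j
  proof -
    have "depth (q (j mod (n * m))) \<le> Max ?D" using pos by (intro Max_ge) auto
    then show ?thesis by (simp add: i q_mod)
  qed
  \<comment> \<open>Adding a full period guarantees that the deepest index has a predecessor, even
    when \<open>i = 0\<close>.\<close>
  obtain k where k: "i + n * m = Suc k" using pos by (metis Suc_pred add_gr_0)
  have "(q (Suc k), q (Suc (Suc k))) \<in> ?E" "(q (Suc k), q k) \<in> ?E"
    using q_edge symD[OF sym_wtree] by blast+
  moreover have "depth (q (Suc (Suc k))) \<le> depth (q (Suc k))" "depth (q k) \<le> depth (q (Suc k))"
    using max period[of i] k by simp_all
  ultimately have "q (Suc (Suc k)) = q k"
    unfolding depth_def by (rule wtree_parent)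
  then show False using q_turn by blast
qed


section \<open>The group of a system of squares\<close>

definition on_code :: "(('x::finite \<times> bool) list \<Rightarrow> ('x \<times> bool) list) \<Rightarrow> nat \<Rightarrow> nat" where
  "on_code h p = enc (h (dec p))"

locale square_group = squares f g
  for f :: "'y::finite \<times> bool \<Rightarrow> 'x::finite \<times> bool \<Rightarrow> 'x \<times> bool" and g
begin

definition fd :: "'x \<times> bool \<Rightarrow> 'y \<times> bool \<Rightarrow> 'y \<times> bool" where
  "fd = (\<lambda>a b. neg (g (neg b) (neg a)))"

definition gd :: "'x \<times> bool \<Rightarrow> 'y \<times> bool \<Rightarrow> 'x \<times> bool" where
  "gd = (\<lambda>a b. neg (f (neg b) (neg a)))"

sublocale dual: squares fd gd
  unfolding fd_def gd_def by (rule dual)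

text \<open>On the first tree the letters \<open>a\<close> act by left multiplication and the
  letters \<open>b\<close> as states of the transducer; \<open>gen2\<close> exchanges these roles by
  means of the dual squares.\<close>

definition gen1 :: "('x \<times> bool) + ('y \<times> bool) \<Rightarrow> nat \<Rightarrow> nat" where
  "gen1 s = on_code (case s of Inl a \<Rightarrow> push a | Inr b \<Rightarrow> run b)"

definition gen2 :: "('x \<times> bool) + ('y \<times> bool) \<Rightarrow> nat \<Rightarrow> nat" where
  "gen2 s = on_code (case s of Inl a \<Rightarrow> dual.run a | Inr b \<Rightarrow> push b)"

abbreviation act1 where "act1 \<equiv> foldr gen1"
abbreviation act2 where "act2 \<equiv> foldr gen2"

definition inverse_word :: "(('x \<times> bool) + ('y \<times> bool)) list \<Rightarrow> (('x \<times> bool) + ('y \<times> bool)) list" where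
  "inverse_word w = rev (map (map_sum neg neg) w)"

lemma inverse_inverse_word: "inverse_word (inverse_word w) = w"
proof -
  have "map_sum neg neg (map_sum neg neg s) = s" for s :: "('x \<times> bool) + ('y \<times> bool)"
    by (cases s) auto
  then show ?thesis by (simp add: inverse_word_def rev_map comp_def)
qed

lemma gen_inverse: "gen1 (map_sum neg neg s) (gen1 s p) = p" "gen2 (map_sum neg neg s) (gen2 s p) = p"
  by (cases s; simp add: gen1_def gen2_def on_code_def reduced_push push_neg_push reduced_run run_neg
      dual.reduced_run dual.run_neg)+

lemma act_inverse1: "act1 (inverse_word w) (act1 w p) = p" "act2 (inverse_word w) (act2 w p) = p"
  by (induction w) (auto simp: inverse_word_def gen_inverse)

lemma act_inverse2: "act1 w (act1 (inverse_word w) p) = p" "act2 w (act2 (inverse_word w) p) = p"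
  using act_inverse1[of "inverse_word w"] by (simp_all add: inverse_inverse_word)

lemma square_relation:
  "gen1 (Inr b) (gen1 (Inl a) p) = gen1 (Inl (f b a)) (gen1 (Inr (g b a)) p)"
  "gen2 (Inr b) (gen2 (Inl a) p) = gen2 (Inl (f b a)) (gen2 (Inr (g b a)) p)"
proof -
  show "gen1 (Inr b) (gen1 (Inl a) p) = gen1 (Inl (f b a)) (gen1 (Inr (g b a)) p)"
    by (simp add: gen1_def on_code_def reduced_push reduced_run run_push)
  have "fd (f b a) (g b a) = b" "gd (f b a) (g b a) = a"
    by (simp_all add: fd_def gd_def opposite_corner)
  then show "gen2 (Inr b) (gen2 (Inl a) p) = gen2 (Inl (f b a)) (gen2 (Inr (g b a)) p)"
    by (simp add: gen2_def on_code_def reduced_push dual.reduced_run dual.run_push)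
qed

lemma state_past_word:
  "gen1 (Inr b) (act1 (map Inl \<alpha>) p) = act1 (map Inl (run b \<alpha>)) (gen1 (Inr (st g b \<alpha>)) p)"
  "gen2 (Inr b) (act2 (map Inl \<alpha>) p) = act2 (map Inl (run b \<alpha>)) (gen2 (Inr (st g b \<alpha>)) p)"
  by (induction \<alpha> arbitrary: b) (simp_all add: square_relation)

text \<open>Words are identified when they act alike on both trees: the group is realized by its
  action rather than by a presentation.\<close>

definition equiv_words where
  "equiv_words u v \<longleftrightarrow> (\<forall>p. act1 u p = act1 v p \<and> act2 u p = act2 v p)"

lemma gen_push:
  "gen1 (Inl a) (act1 (map Inl w) p) = act1 (map Inl (push a w)) p"
  "gen2 (Inl a) (act2 (map Inl w) p) = act2 (map Inl (push a w)) p"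
  "gen1 (Inr b) (act1 (map Inr v) p) = act1 (map Inr (push b v)) p"
  "gen2 (Inr b) (act2 (map Inr v) p) = act2 (map Inr (push b v)) p"
proof -
  have *: "gen1 (Inl c) (gen1 (Inl (neg c)) p) = p" "gen2 (Inl c) (gen2 (Inl (neg c)) p) = p"
    "gen1 (Inr d) (gen1 (Inr (neg d)) p) = p" "gen2 (Inr d) (gen2 (Inr (neg d)) p) = p" for c d p
    using gen_inverse[of "Inl (neg c)" p] gen_inverse[of "Inr (neg d)" p] by simp_all
  show "gen1 (Inl a) (act1 (map Inl w) p) = act1 (map Inl (push a w)) p"
    "gen2 (Inl a) (act2 (map Inl w) p) = act2 (map Inl (push a w)) p"
    by (cases w; simp add: *)+
  show "gen1 (Inr b) (act1 (map Inr v) p) = act1 (map Inr (push b v)) p"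
    "gen2 (Inr b) (act2 (map Inr v) p) = act2 (map Inr (push b v)) p"
    by (cases v; simp add: *)+
qed

text \<open>Induction on the word. A new letter \<open>a\<close> is pushed onto \<alpha>; a new
  letter \<open>b\<close> transforms \<alpha> and leaves it as the state
  \<open>st g b \<alpha>\<close>, which is pushed onto \<beta>.\<close>

lemma normal_form:
  obtains \<alpha> \<beta> where "reduced \<alpha>" "reduced \<beta>" "equiv_words w (map Inl \<alpha> @ map Inr \<beta>)"
proof -
  have "\<exists>\<alpha> \<beta>. reduced \<alpha> \<and> reduced \<beta> \<and> equiv_words w (map Inl \<alpha> @ map Inr \<beta>)"
  proof (induction w)
    case Nil
    show ?case by (rule exI[of _ "[]"], rule exI[of _ "[]"]) (simp add: equiv_words_def)
  next
    case (Cons s w)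
    then obtain \<alpha> \<beta> where *: "reduced \<alpha>" "reduced \<beta>" "equiv_words w (map Inl \<alpha> @ map Inr \<beta>)"
      by blast
    show ?case
    proof (cases s)
      case (Inl a)
      have "equiv_words (s # w) (map Inl (push a \<alpha>) @ map Inr \<beta>)"
        using *(3) by (simp add: equiv_words_def Inl gen_push)
      then show ?thesis using * reduced_push by blast
    next
      case (Inr b)
      have "equiv_words (s # w) (map Inl (run b \<alpha>) @ map Inr (push (st g b \<alpha>) \<beta>))"
        using *(3) by (simp add: equiv_words_def Inr state_past_word gen_push)
      then show ?thesis using * reduced_push reduced_run by blast
    qed
  qed
  then show thesis using that by blast
qed

lemma gen_root: "gen1 (Inr b) (wroot TYPE('x)) = wroot TYPE('x)" "gen2 (Inl a) (wroot TYPE('y)) = wroot TYPE('y)"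
  by (simp_all add: gen1_def gen2_def on_code_def)

lemma act_root: "act1 (map Inr \<beta>) (wroot TYPE('x)) = wroot TYPE('x)" "act2 (map Inl \<alpha>) (wroot TYPE('y)) = wroot TYPE('y)"
proof -
  show "act1 (map Inr \<beta>) (wroot TYPE('x)) = wroot TYPE('x)" by (induction \<beta>) (auto simp: gen_root)
  show "act2 (map Inl \<alpha>) (wroot TYPE('y)) = wroot TYPE('y)" by (induction \<alpha>) (auto simp: gen_root)
qed

lemma gen_own1: "reduced (a # \<alpha>) \<Longrightarrow> gen1 (Inl a) (enc \<alpha>) = enc (a # \<alpha>)"
  and gen_own2: "reduced (b # \<beta>) \<Longrightarrow> gen2 (Inr b) (enc \<beta>) = enc (b # \<beta>)"
  using reduced_ConsD[of a \<alpha>] reduced_ConsD[of b \<beta>]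
  by (simp_all add: gen1_def gen2_def on_code_def push_reduced_Cons)

lemma act_own_root:
  "reduced \<alpha> \<Longrightarrow> act1 (map Inl \<alpha>) (wroot TYPE('x)) = enc \<alpha>"
  "reduced \<beta> \<Longrightarrow> act2 (map Inr \<beta>) (wroot TYPE('y)) = enc \<beta>"
proof -
  show "reduced \<alpha> \<Longrightarrow> act1 (map Inl \<alpha>) (wroot TYPE('x)) = enc \<alpha>"
  proof (induction \<alpha>)
    case (Cons a \<alpha>)
    then have "act1 (map Inl \<alpha>) (wroot TYPE('x)) = enc \<alpha>" "reduced \<alpha>" using reduced_ConsD by blast+
    then show ?case using Cons.prems gen_own1[of a \<alpha>] by simp
  qed simp
  show "reduced \<beta> \<Longrightarrow> act2 (map Inr \<beta>) (wroot TYPE('y)) = enc \<beta>"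
  proof (induction \<beta>)
    case (Cons b \<beta>)
    then have "act2 (map Inr \<beta>) (wroot TYPE('y)) = enc \<beta>" "reduced \<beta>" using reduced_ConsD by blast+
    then show ?case using Cons.prems gen_own2[of b \<beta>] by simp
  qed simp
qed

text \<open>The normal form can be read off the roots: \<beta> fixes the first root, so its image is
  \<alpha>. Once \<alpha> is empty, the image of the second root is \<beta>.\<close>

lemma free_at_root:
  assumes "act1 w (wroot TYPE('x)) = wroot TYPE('x)" "act2 w (wroot TYPE('y)) = wroot TYPE('y)"
  shows "act1 w p = p" "act2 w p = p"
proof -
  obtain \<alpha> \<beta> where *: "reduced \<alpha>" "reduced \<beta>" "equiv_words w (map Inl \<alpha> @ map Inr \<beta>)"
    by (rule normal_form)
  have "act1 w (wroot TYPE('x)) = enc \<alpha>"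
    using * by (simp add: equiv_words_def act_root act_own_root)
  then have "\<alpha> = []" using * assms enc_eq_root by metis
  moreover have "act2 w (wroot TYPE('y)) = enc \<beta>"
    using * \<open>\<alpha> = []\<close> by (simp add: equiv_words_def act_own_root)
  then have "\<beta> = []" using * assms enc_eq_root by metis
  ultimately show "act1 w p = p" "act2 w p = p"
    using *(3) by (simp_all add: equiv_words_def)
qed

text \<open>By freeness an element is determined by the images of the two roots. Encoding this pair
  makes all of \<open>nat\<close> the carrier of the group.\<close>

definition code :: "(('x \<times> bool) + ('y \<times> bool)) list \<Rightarrow> nat" where
  "code w = prod_encode (act1 w (wroot TYPE('x)), act2 w (wroot TYPE('y)))"

lemma code_eq_iff: "code u = code v \<longleftrightarrow> equiv_words u v"
proof
  assume "code u = code v"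
  then have "act1 (inverse_word v @ u) (wroot TYPE('x)) = wroot TYPE('x)" "act2 (inverse_word v @ u) (wroot TYPE('y)) = wroot TYPE('y)"
    by (simp_all add: code_def act_inverse1)
  from free_at_root[OF this] show "equiv_words u v"
    by (metis act_inverse2 equiv_words_def foldr_append o_apply)
qed (simp add: code_def equiv_words_def)

lemma surj_code: "\<exists>w. code w = n"
proof -
  obtain p q where n: "n = prod_encode (p, q)" by (metis prod_decode_inverse surj_pair)
  let ?u = "map Inl (dec p)"
  \<comment> \<open>The word \<open>?u\<close> settles the first coordinate, and \<open>?v\<close>
    leaves it alone since it fixes the first root. The second target is pulled back through
    \<open>?u\<close> beforehand.\<close>
  let ?v = "map Inr (dec (act2 (inverse_word ?u) q))"
  have "code (?u @ ?v) = n"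
    by (simp add: code_def n act_root act_own_root act_inverse2)
  then show ?thesis by blast
qed

definition rep :: "nat \<Rightarrow> (('x \<times> bool) + ('y \<times> bool)) list" where
  "rep n = (SOME w. code w = n)"

lemma code_rep [simp]: "code (rep n) = n"
  unfolding rep_def using surj_code by (rule someI_ex)

definition G :: "nat monoid" where
  "G = \<lparr>carrier = UNIV, monoid.mult = (\<lambda>m n. code (rep m @ rep n)), one = code []\<rparr>"

lemma carrier_G [simp]: "carrier G = UNIV"
  by (simp add: G_def)

lemma one_G: "\<one>\<^bsub>G\<^esub> = code []"
  by (simp add: G_def)

lemma mult_G: "code u \<otimes>\<^bsub>G\<^esub> code v = code (u @ v)"
proof -
  have "equiv_words (rep (code u)) u" for u by (simp flip: code_eq_iff)
  then have "equiv_words (rep (code u) @ rep (code v)) (u @ v)"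
    by (simp add: equiv_words_def)
  then show ?thesis by (simp add: G_def code_eq_iff)
qed

lemma inverse_word_G: "code (inverse_word w) \<otimes>\<^bsub>G\<^esub> code w = \<one>\<^bsub>G\<^esub>"
  by (simp add: mult_G one_G code_eq_iff equiv_words_def act_inverse1)

sublocale G: group G
proof (rule groupI)
  fix x y z
  show "x \<otimes>\<^bsub>G\<^esub> y \<otimes>\<^bsub>G\<^esub> z = x \<otimes>\<^bsub>G\<^esub> (y \<otimes>\<^bsub>G\<^esub> z)"
    using mult_G[of "rep x @ rep y" "rep z"] mult_G[of "rep x" "rep y @ rep z"]
      mult_G[of "rep x" "rep y"] mult_G[of "rep y" "rep z"] by simp
  show "\<one>\<^bsub>G\<^esub> \<otimes>\<^bsub>G\<^esub> x = x"
    using mult_G[of "[]" "rep x"] by (simp add: one_G)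
  show "\<exists>y\<in>carrier G. y \<otimes>\<^bsub>G\<^esub> x = \<one>\<^bsub>G\<^esub>"
    using inverse_word_G[of "rep x"] by auto
qed auto

lemma inv_G: "inv\<^bsub>G\<^esub> code w = code (inverse_word w)"
  by (rule G.inv_equality) (auto simp: inverse_word_G)

section \<open>The action of the group on the two trees\<close>

definition \<rho>1 :: "nat \<Rightarrow> nat \<Rightarrow> nat" where "\<rho>1 n = act1 (rep n)"
definition \<rho>2 :: "nat \<Rightarrow> nat \<Rightarrow> nat" where "\<rho>2 n = act2 (rep n)"

lemma \<rho>_code: "\<rho>1 (code w) p = act1 w p" "\<rho>2 (code w) p = act2 w p"
  using code_eq_iff[of "rep (code w)" w] by (simp_all add: \<rho>1_def \<rho>2_def equiv_words_def)

lemma \<rho>_mult: "\<rho>1 (x \<otimes>\<^bsub>G\<^esub> y) p = \<rho>1 x (\<rho>1 y p)" "\<rho>2 (x \<otimes>\<^bsub>G\<^esub> y) p = \<rho>2 x (\<rho>2 y p)"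
  using mult_G[of "rep x" "rep y"] \<rho>_code[of "rep x @ rep y"] by (simp_all add: \<rho>1_def \<rho>2_def)

lemma \<rho>_one: "\<rho>1 \<one>\<^bsub>G\<^esub> p = p" "\<rho>2 \<one>\<^bsub>G\<^esub> p = p"
  by (simp_all add: one_G \<rho>_code)

lemma \<rho>_inv:
  "\<rho>1 (inv\<^bsub>G\<^esub> x) (\<rho>1 x p) = p" "\<rho>2 (inv\<^bsub>G\<^esub> x) (\<rho>2 x p) = p"
  using \<rho>_mult[of "inv\<^bsub>G\<^esub> x" x] by (simp_all add: G.l_inv \<rho>_one)

lemma \<rho>_root_free:
  assumes "\<rho>1 x (wroot TYPE('x)) = wroot TYPE('x)" "\<rho>2 x (wroot TYPE('y)) = wroot TYPE('y)"
  shows "x = \<one>\<^bsub>G\<^esub>"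
proof -
  have "equiv_words (rep x) []"
    using assms free_at_root[of "rep x"] by (simp add: equiv_words_def \<rho>1_def \<rho>2_def)
  then have "code (rep x) = code []" by (simp only: code_eq_iff)
  then show ?thesis by (simp add: one_G)
qed

lemma \<rho>_root_transitive: "\<exists>x. \<rho>1 x (wroot TYPE('x)) = p \<and> \<rho>2 x (wroot TYPE('y)) = q"
  using surj_code[of "prod_encode (p, q)"] by (metis \<rho>_code code_def prod.inject prod_encode_eq)

lemma \<rho>_transitive: "\<exists>x. \<rho>1 x p = p' \<and> \<rho>2 x q = q'"
proof -
  obtain y where y: "\<rho>1 y (wroot TYPE('x)) = p" "\<rho>2 y (wroot TYPE('y)) = q" using \<rho>_root_transitive by blast
  obtain z where z: "\<rho>1 z (wroot TYPE('x)) = p'" "\<rho>2 z (wroot TYPE('y)) = q'" using \<rho>_root_transitive by blast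
  have "\<rho>1 (z \<otimes>\<^bsub>G\<^esub> inv\<^bsub>G\<^esub> y) p = p'" "\<rho>2 (z \<otimes>\<^bsub>G\<^esub> inv\<^bsub>G\<^esub> y) q = q'"
    using y z by (auto simp: \<rho>_mult \<rho>_inv)
  then show ?thesis by blast
qed

text \<open>Conjugation by an element that carries the roots to \<open>p\<close> and
  \<open>q\<close> reduces this to the trivial stabilizer of the pair of roots.\<close>

lemma \<rho>_free:
  assumes "\<rho>1 x p = \<rho>1 y p" "\<rho>2 x q = \<rho>2 y q"
  shows "x = y"
proof -
  obtain z where z: "\<rho>1 z (wroot TYPE('x)) = p" "\<rho>2 z (wroot TYPE('y)) = q" using \<rho>_root_transitive by blast
  let ?w = "inv\<^bsub>G\<^esub> z \<otimes>\<^bsub>G\<^esub> (inv\<^bsub>G\<^esub> y \<otimes>\<^bsub>G\<^esub> x) \<otimes>\<^bsub>G\<^esub> z"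
  have "\<rho>1 ?w (wroot TYPE('x)) = wroot TYPE('x)" "\<rho>2 ?w (wroot TYPE('y)) = wroot TYPE('y)"
    using z assms by (auto simp: \<rho>_mult) (metis \<rho>_inv)+
  then have w: "?w = \<one>\<^bsub>G\<^esub>" by (rule \<rho>_root_free)
  have "z \<otimes>\<^bsub>G\<^esub> ?w = inv\<^bsub>G\<^esub> y \<otimes>\<^bsub>G\<^esub> x \<otimes>\<^bsub>G\<^esub> z"
    by (simp add: G.r_inv flip: G.m_assoc)
  then have "inv\<^bsub>G\<^esub> y \<otimes>\<^bsub>G\<^esub> x \<otimes>\<^bsub>G\<^esub> z = \<one>\<^bsub>G\<^esub> \<otimes>\<^bsub>G\<^esub> z" by (simp add: w)
  then have "inv\<^bsub>G\<^esub> y \<otimes>\<^bsub>G\<^esub> x = \<one>\<^bsub>G\<^esub>" by (subst (asm) G.right_cancel) simp_all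
  then show ?thesis
    by (metis G.inv_closed G.inv_equality G.inv_inv UNIV_I carrier_G)
qed

lemma gen_edge:
  "(p, q) \<in> wtree TYPE('x) \<Longrightarrow> (gen1 s p, gen1 s q) \<in> wtree TYPE('x)"
  "(p, q) \<in> wtree TYPE('y) \<Longrightarrow> (gen2 s p, gen2 s q) \<in> wtree TYPE('y)"
  by (cases s; simp add: wtree_def gen1_def gen2_def on_code_def reduced_push reduced_run
      dual.reduced_run adj_push adj_tr)+

lemma \<rho>_edge:
  "(p, q) \<in> wtree TYPE('x) \<Longrightarrow> (\<rho>1 x p, \<rho>1 x q) \<in> wtree TYPE('x)"
  "(p, q) \<in> wtree TYPE('y) \<Longrightarrow> (\<rho>2 x p, \<rho>2 x q) \<in> wtree TYPE('y)"
proof -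
  have "(p, q) \<in> wtree TYPE('x) \<Longrightarrow> (act1 w p, act1 w q) \<in> wtree TYPE('x)" for w
    by (induction w) (auto intro: gen_edge)
  then show "(p, q) \<in> wtree TYPE('x) \<Longrightarrow> (\<rho>1 x p, \<rho>1 x q) \<in> wtree TYPE('x)"
    by (simp add: \<rho>1_def)
  have "(p, q) \<in> wtree TYPE('y) \<Longrightarrow> (act2 w p, act2 w q) \<in> wtree TYPE('y)" for w
    by (induction w) (auto intro: gen_edge)
  then show "(p, q) \<in> wtree TYPE('y) \<Longrightarrow> (\<rho>2 x p, \<rho>2 x q) \<in> wtree TYPE('y)"
    by (simp add: \<rho>2_def)
qed

sublocale two_tree_action G \<rho>1 "wtree TYPE('x)" \<rho>2 "wtree TYPE('y)"
proof unfold_locales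
  show "\<exists>x\<in>carrier G. \<rho>1 x p = p' \<and> \<rho>2 x q = q'" for p p' q q'
    using \<rho>_transitive by simp
qed (assumption | rule is_tree_wtree \<rho>_mult \<rho>_one \<rho>_edge wtree_neighbour wtree_locally_finite \<rho>_free)+

section \<open>Heights and the absence of torsion\<close>

lemma hgt_gen:
  "\<exists>c. \<forall>p. hgt (dec (gen1 s p) :: ('x \<times> bool) list) = hgt (dec p :: ('x \<times> bool) list) + c"
  "\<exists>c. \<forall>p. hgt (dec (gen2 s p) :: ('y \<times> bool) list) = hgt (dec p :: ('y \<times> bool) list) + c"
  by (cases s; force simp: gen1_def gen2_def on_code_def reduced_push reduced_run
      dual.reduced_run hgt_push hgt_run dual.hgt_run)+

lemma hgt_\<rho>:
  "\<exists>c. \<forall>p. hgt (dec (\<rho>1 x p) :: ('x \<times> bool) list) = hgt (dec p :: ('x \<times> bool) list) + c"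
  "\<exists>c. \<forall>p. hgt (dec (\<rho>2 x p) :: ('y \<times> bool) list) = hgt (dec p :: ('y \<times> bool) list) + c"
proof -
  have "\<exists>c. \<forall>p. hgt (dec (act1 w p) :: ('x \<times> bool) list) = hgt (dec p :: ('x \<times> bool) list) + c" for w
  proof (induction w)
    case (Cons s w)
    then show ?case using hgt_gen(1)[of s] by (metis add.assoc comp_apply foldr_Cons)
  qed (auto intro: exI[of _ 0])
  then show "\<exists>c. \<forall>p. hgt (dec (\<rho>1 x p) :: ('x \<times> bool) list) = hgt (dec p :: ('x \<times> bool) list) + c"
    by (simp add: \<rho>1_def)
  have "\<exists>c. \<forall>p. hgt (dec (act2 w p) :: ('y \<times> bool) list) = hgt (dec p :: ('y \<times> bool) list) + c" for w
  proof (induction w)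
    case (Cons s w)
    then show ?case using hgt_gen(2)[of s] by (metis add.assoc comp_apply foldr_Cons)
  qed (auto intro: exI[of _ 0])
  then show "\<exists>c. \<forall>p. hgt (dec (\<rho>2 x p) :: ('y \<times> bool) list) = hgt (dec p :: ('y \<times> bool) list) + c"
    by (simp add: \<rho>2_def)
qed

lemma \<rho>_pow: "(\<rho>1 x ^^ n) p = \<rho>1 (x [^]\<^bsub>G\<^esub> n) p" "(\<rho>2 x ^^ n) p = \<rho>2 (x [^]\<^bsub>G\<^esub> n) p"
proof -
  have "x \<otimes>\<^bsub>G\<^esub> x [^]\<^bsub>G\<^esub> k = x [^]\<^bsub>G\<^esub> Suc k" for k :: nat
    by (metis G.nat_pow_Suc2 UNIV_I carrier_G)
  then show "(\<rho>1 x ^^ n) p = \<rho>1 (x [^]\<^bsub>G\<^esub> n) p" "(\<rho>2 x ^^ n) p = \<rho>2 (x [^]\<^bsub>G\<^esub> n) p"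
    by (induction n) (auto simp: \<rho>_one simp flip: \<rho>_mult simp del: G.nat_pow_Suc)
qed

text \<open>An element of finite order fixes a vertex in each tree, hence a pair of vertices, and
  the action on pairs is free.\<close>

lemma torsion_free_G: "torsion_free G"
  unfolding torsion_free_def
proof (intro ballI allI impI)
  fix x :: nat and n :: nat
  assume n: "n > 0 \<and> x [^]\<^bsub>G\<^esub> n = \<one>\<^bsub>G\<^esub>"
  have "\<exists>p. \<rho>1 x p = p"
    using hgt_\<rho>(1)[of x] n fixed_vertex[of "TYPE('x)" "\<rho>1 x" _ n]
    by (metis \<rho>_edge(1) \<rho>_one(1) \<rho>_pow(1))
  then obtain p where p: "\<rho>1 x p = p" by blast
  have "\<exists>q. \<rho>2 x q = q"
    using hgt_\<rho>(2)[of x] n fixed_vertex[of "TYPE('y)" "\<rho>2 x" _ n]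
    by (metis \<rho>_edge(2) \<rho>_one(2) \<rho>_pow(2))
  then obtain q where q: "\<rho>2 x q = q" by blast
  show "x = \<one>\<^bsub>G\<^esub>"
    using p q by (intro \<rho>_free[of x p _ q]) (simp_all add: \<rho>_one)
qed

end

section \<open>Commensurators of infinite cyclic subgroups\<close>

text \<open>Pigeonhole: two of the cosets \<open>J c^i\<close> coincide, and the quotient of the two
  powers lies in \<open>J\<close>.\<close>

lemma (in group) finite_index_power:
  assumes "subgroup H G" "subgroup J G" "J \<subseteq> H" "finite_index_in G J H" "c \<in> H"
  shows "\<exists>n>0. c [^] (n::nat) \<in> J"
proof -
  let ?f = "\<lambda>i::nat. J #> c [^] i"
  interpret H: subgroup H G by (rule assms(1))
  have c: "c \<in> carrier G" using assms(5) by (rule H.mem_carrier)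
  have "c [^] i \<in> H" for i :: nat
    by (induction i) (simp_all add: assms(5))
  then have "range ?f \<subseteq> rcosets\<^bsub>G\<lparr>carrier := H\<rparr>\<^esub> J"
    by (auto simp: RCOSETS_def r_coset_def)
  then have "finite (range ?f)"
    using assms(4) finite_subset unfolding finite_index_in_def by blast
  then have "\<not> inj ?f" using finite_imageD by blast
  then obtain i j where "i \<noteq> j" "?f i = ?f j" by (auto simp: inj_def)
  then obtain i j where "i < j" "?f i = ?f j" by (cases i j rule: linorder_cases) auto
  moreover have "c [^] j \<in> ?f j"
    using subgroup.one_closed[OF assms(2)] c by (force simp: r_coset_def)
  ultimately obtain u where u: "u \<in> J" "c [^] j = u \<otimes> c [^] i"
    by (auto simp: r_coset_def)
  have "u \<otimes> c [^] i = c [^] (j - i) \<otimes> c [^] i"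
    using u(2) c \<open>i < j\<close> by (simp add: nat_pow_mult)
  then have "u = c [^] (j - i)"
    using u(1) subgroup.mem_carrier[OF assms(2)] c by (subst (asm) right_cancel) auto
  then show ?thesis using u(1) \<open>i < j\<close> by (intro exI[of _ "j - i"]) simp
qed

text \<open>The coset of \<open>e i\<close> depends only on \<open>i\<close> modulo
  \<open>n\<close>. The form with a homomorphism \<open>e\<close> from the integers serves both
  \<open>H\<close> and its conjugates.\<close>

lemma (in group) finite_index_cyclic:
  fixes e :: "int \<Rightarrow> 'a"
  assumes "subgroup J G" "\<And>i. e i \<in> carrier G" "\<And>i j. e (i + j) = e i \<otimes> e j"
    and "n > 0" "e (int n) \<in> J"
  shows "finite_index_in G J (range e)"
proof -
  have "e 0 \<otimes> e 0 = e 0" using assms(3)[of 0 0] by simp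
  then have e0: "e 0 = \<one>" using assms(2) by (simp add: l_cancel_one)
  have mult: "e (int n * int k) \<in> J" for k
    by (induction k) (auto simp: e0 distrib_left assms(3,5) subgroup.one_closed[OF assms(1)]
        subgroup.m_closed[OF assms(1)])
  have "e (- i) \<in> J" if "e i \<in> J" for i
  proof -
    have "e (- i) = inv (e i)"
      using assms(3)[of "-i" i] e0 by (intro inv_equality[symmetric]) (auto simp: assms(2))
    then show ?thesis using that subgroup.m_inv_closed[OF assms(1)] by simp
  qed
  with mult have mult: "e (int n * i) \<in> J" for i
    by (cases i rule: int_cases2) (metis mult_minus_right)+
  have "rcosets\<^bsub>G\<lparr>carrier := range e\<rparr>\<^esub> J \<subseteq> (\<lambda>i. J #> e i) ` {0..<int n}"
  proof
    fix A assume "A \<in> rcosets\<^bsub>G\<lparr>carrier := range e\<rparr>\<^esub> J"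
    then obtain i where A: "A = J #> e i"
      by (auto simp: RCOSETS_def r_coset_def)
    have "e i = e (int n * (i div int n)) \<otimes> e (i mod int n)"
      by (simp flip: assms(3))
    then have "A = (J #> e (int n * (i div int n))) #> e (i mod int n)"
      using A assms(2) subgroup.subset[OF assms(1)] by (simp add: coset_mult_assoc)
    also have "J #> e (int n * (i div int n)) = J"
      using mult assms(1,2) by (intro coset_join2) auto
    finally show "A \<in> (\<lambda>i. J #> e i) ` {0..<int n}"
      using assms(4) by (intro image_eqI[of _ _ "i mod int n"]) auto
  qed
  then show ?thesis
    unfolding finite_index_in_def by (rule finite_subset) simp
qed

text \<open>A homomorphism to the integers with value 1 at \<open>c\<close> makes the powers of
  \<open>c\<close> distinct. Being invariant under conjugation, it also keeps different powers of
  \<open>c\<close> from being conjugate.\<close>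

locale character_one = group G for G (structure) +
  fixes \<delta> :: "'a \<Rightarrow> int" and c
  assumes \<delta>_mult: "x \<in> carrier G \<Longrightarrow> y \<in> carrier G \<Longrightarrow> \<delta> (x \<otimes> y) = \<delta> x + \<delta> y"
    and c_closed [simp]: "c \<in> carrier G"
    and \<delta>_c: "\<delta> c = 1"
begin

lemma \<delta>_pow: "\<delta> (c [^] (i::int)) = i"
proof -
  interpret group_hom G integer_group \<delta>
    by (intro group_hom.intro group_hom_axioms.intro) (auto simp: hom_def \<delta>_mult)
  show ?thesis using hom_int_pow[of c i] by (simp add: \<delta>_c)
qed

lemma \<delta>_inv: "x \<in> carrier G \<Longrightarrow> \<delta> (inv x) = - \<delta> x"
  using \<delta>_mult[of x "inv x"] \<delta>_mult[of \<one> \<one>] by simp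

abbreviation H where "H \<equiv> range (\<lambda>i::int. c [^] i)"

lemma subgroup_H: "subgroup H G"
proof -
  have "H = generate G {c}" by (auto simp: generate_pow)
  then show ?thesis using generate_is_subgroup[of "{c}"] by simp
qed

lemma H_iso: "G\<lparr>carrier := H\<rparr> \<cong> integer_group"
proof -
  have "\<delta> \<in> iso (G\<lparr>carrier := H\<rparr>) integer_group"
    unfolding iso_iff by (auto simp: hom_def \<delta>_mult \<delta>_pow inj_on_def image_image)
  then show ?thesis by (rule is_isoI)
qed

lemma commutes_if_conj_power:
  assumes "y \<in> carrier G" "c [^] (n::nat) = y \<otimes> c [^] (i::int) \<otimes> inv y"
  shows "y \<otimes> c [^] n = c [^] n \<otimes> y"
proof -
  have "\<delta> (c [^] n) = \<delta> (c [^] i)"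
    using assms by (simp add: \<delta>_mult \<delta>_inv)
  then have "i = int n" using \<delta>_pow[of "int n"] \<delta>_pow[of i] by (simp add: int_pow_int)
  then have "c [^] n = y \<otimes> c [^] n \<otimes> inv y"
    using assms(2) by (simp add: int_pow_int)
  then show ?thesis using assms(1) by (metis c_closed inv_solve_right m_closed nat_pow_closed)
qed

lemma conj_H: "y \<in> carrier G \<Longrightarrow> y <# H #> inv y = range (\<lambda>i::int. y \<otimes> c [^] i \<otimes> inv y)"
  by (auto simp: l_coset_def r_coset_def)

lemma conj_H_mult:
  "y \<in> carrier G \<Longrightarrow>
    y \<otimes> c [^] (i + j :: int) \<otimes> inv y = (y \<otimes> c [^] i \<otimes> inv y) \<otimes> (y \<otimes> c [^] j \<otimes> inv y)"
  by (simp add: int_pow_mult m_assoc) (simp flip: m_assoc)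

text \<open>For cyclic \<open>H\<close>, finite index of the intersection amounts to a common
  positive power \<open>c^n\<close>. By \<open>commutes_if_conj_power\<close> this power is
  centralized, not merely conjugate to some power.\<close>

lemma commensurator_H:
  "commensurator G H = {y \<in> carrier G. \<exists>n>0. y \<otimes> c [^] (n::nat) = c [^] n \<otimes> y}"
proof (intro equalityI subsetI)
  fix y assume "y \<in> commensurator G H"
  then have y: "y \<in> carrier G" "finite_index_in G ((y <# H #> inv y) \<inter> H) H"
    by (auto simp: commensurator_def commensurable_def)
  have "subgroup ((y <# H #> inv y) \<inter> H) G"
    using subgroup_conjugation_is_surj2 subgroup_H y(1) by (intro subgroups_Inter_pair) auto
  moreover have "c \<in> H" by (rule image_eqI[of _ _ 1]) simp_all
  ultimately obtain n where "n > 0" "c [^] (n::nat) \<in> y <# H #> inv y"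
    using finite_index_power[OF subgroup_H _ _ y(2)] by blast
  then show "y \<in> {y \<in> carrier G. \<exists>n>0. y \<otimes> c [^] (n::nat) = c [^] n \<otimes> y}"
    using y(1) commutes_if_conj_power conj_H[OF y(1)] by auto
next
  fix y assume "y \<in> {y \<in> carrier G. \<exists>n>0. y \<otimes> c [^] (n::nat) = c [^] n \<otimes> y}"
  then obtain n :: nat where y: "y \<in> carrier G" and n: "n > 0" "y \<otimes> c [^] n = c [^] n \<otimes> y"
    by blast
  have J: "subgroup ((y <# H #> inv y) \<inter> H) G"
    using subgroup_conjugation_is_surj2 subgroup_H y(1) by (intro subgroups_Inter_pair) auto
  have conj: "y \<otimes> c [^] int n \<otimes> inv y = c [^] int n"
    using n(2) y by (simp add: int_pow_int m_assoc)
  then have "c [^] int n \<in> (y <# H #> inv y) \<inter> H"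
    unfolding conj_H[OF y] by (metis IntI rangeI)
  then have "finite_index_in G ((y <# H #> inv y) \<inter> H) H"
    "finite_index_in G ((y <# H #> inv y) \<inter> H) (range (\<lambda>i::int. y \<otimes> c [^] i \<otimes> inv y))"
    using y conj
    using finite_index_cyclic[OF J _ _ n(1), of "\<lambda>i. c [^] i"]
      finite_index_cyclic[OF J _ conj_H_mult[OF y] n(1)]
    by (simp_all add: int_pow_mult del: Int_iff)
  then show "y \<in> commensurator G H"
    using y by (simp add: commensurator_def commensurable_def conj_H)
qed

text \<open>Finite index puts some \<open>c^n\<close> into \<open>K\<close>. An element that
  normalizes \<open>K\<close> exhibits \<open>c^n\<close> as a conjugate of a power of
  \<open>c\<close>, so the character makes the two commute.\<close>

lemma normalizer_commutes:
  assumes "subgroup K G" "K \<subseteq> H" "finite_index_in G K H"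
  obtains n :: nat where "n > 0" "\<And>y. y \<in> normalizer G K \<Longrightarrow> y \<otimes> c [^] n = c [^] n \<otimes> y"
proof -
  have "c \<in> H" by (rule image_eqI[of _ _ 1]) simp_all
  then obtain n :: nat where n: "n > 0" "c [^] n \<in> K"
    using finite_index_power[OF subgroup_H assms(1,2,3)] by blast
  have "y \<otimes> c [^] n = c [^] n \<otimes> y" if "y \<in> normalizer G K" for y
  proof -
    have y: "y \<in> carrier G" "y <# K #> inv y = K"
      using that subgroup.subset[OF assms(1)] by (auto simp: normalizer_def stabilizer_def)
    then have "c [^] n \<in> y <# H #> inv y"
      using n(2) assms(2) by (fastforce simp: l_coset_def r_coset_def)
    then show ?thesis using commutes_if_conj_power[OF y(1)] conj_H[OF y(1)] by auto
  qed
  then show thesis using that n(1) by blast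
qed

lemma commutes_power_mult:
  assumes "y \<in> carrier G" "y \<otimes> c [^] (n::nat) = c [^] n \<otimes> y"
  shows "y \<otimes> c [^] (n * k) = c [^] (n * k) \<otimes> y"
proof (induction k)
  case (Suc k)
  have "y \<otimes> c [^] (n * Suc k) = (y \<otimes> c [^] n) \<otimes> c [^] (n * k)"
    using assms(1) by (simp add: m_assoc nat_pow_mult)
  also have "\<dots> = c [^] n \<otimes> (y \<otimes> c [^] (n * k))"
    using assms by (simp add: m_assoc)
  also have "\<dots> = c [^] (n * Suc k) \<otimes> y"
    using assms(1) Suc.IH by (simp add: nat_pow_mult flip: m_assoc)
  finally show ?case .
qed (use assms in simp)

lemma finite_commutes:
  assumes "finite S" "S \<subseteq> commensurator G H"
  shows "\<exists>n>0. \<forall>y\<in>S. y \<otimes> c [^] (n::nat) = c [^] n \<otimes> y"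
  using assms
proof (induction S)
  case (insert x S)
  then obtain n :: nat where n: "n > 0" "\<And>y. y \<in> S \<Longrightarrow> y \<otimes> c [^] n = c [^] n \<otimes> y" by auto
  obtain m :: nat where m: "m > 0" "x \<otimes> c [^] m = c [^] m \<otimes> x"
    using insert.prems by (auto simp: commensurator_H)
  have in_G: "y \<in> carrier G" if "y \<in> insert x S" for y
    using that insert.prems by (auto simp: commensurator_H)
  have "y \<otimes> c [^] (n * m) = c [^] (n * m) \<otimes> y" if "y \<in> insert x S" for y
    using that n(2) m(2) in_G[OF that] commutes_power_mult[of y n m] commutes_power_mult[of y m n]
    by (auto simp: mult.commute)
  then show ?case using n(1) m(1) by (intro exI[of _ "n * m"]) auto
qed (auto intro: exI[of _ 1])

text \<open>Finitely many generators commute with one common power \<open>c^n\<close>, so the whole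
  commensurator would lie in the centralizer of \<open>c^n\<close>.\<close>

lemma not_fin_gen_commensurator:
  assumes "\<And>n::nat. n > 0 \<Longrightarrow> \<exists>y\<in>commensurator G H. y \<otimes> c [^] n \<noteq> c [^] n \<otimes> y"
  shows "\<not> fin_gen_subgroup G (commensurator G H)"
proof
  assume "fin_gen_subgroup G (commensurator G H)"
  then obtain S where S: "finite S" "S \<subseteq> commensurator G H" "generate G S = commensurator G H"
    by (auto simp: fin_gen_subgroup_def)
  obtain n :: nat where n: "n > 0" "\<And>y. y \<in> S \<Longrightarrow> y \<otimes> c [^] n = c [^] n \<otimes> y"
    using finite_commutes[OF S(1,2)] by blast
  let ?C = "{y \<in> carrier G. y \<otimes> c [^] n = c [^] n \<otimes> y}"
  have "subgroup ?C G"
  proof (rule subgroupI)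
    show "inv a \<in> ?C" if "a \<in> ?C" for a
      using that by (simp add: inv_solve_left' m_assoc) (metis c_closed inv_solve_left inv_solve_right inv_closed m_assoc m_closed nat_pow_closed)
    show "a \<otimes> b \<in> ?C" if "a \<in> ?C" "b \<in> ?C" for a b
      using that by simp (metis c_closed m_assoc nat_pow_closed)
  qed auto
  moreover have "S \<subseteq> ?C" using S(2) n(2) by (auto simp: commensurator_H)
  ultimately have "generate G S \<subseteq> ?C" by (rule generate_subgroup_incl[rotated])
  then show False using assms[OF n(1)] S(3) by blast
qed

lemma not_normalized:
  assumes "\<And>n::nat. n > 0 \<Longrightarrow> \<exists>y\<in>commensurator G H. y \<otimes> c [^] n \<noteq> c [^] n \<otimes> y"
    and "subgroup K G" "K \<subseteq> H" "finite_index_in G K H"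
  shows "\<not> commensurator G H \<subseteq> normalizer G K"
  using normalizer_commutes[OF assms(2-4)] assms(1) by (metis subsetD)

end

section \<open>A letter commuting with all states\<close>

locale commuting_letter = square_group f g
  for f :: "'y::finite \<times> bool \<Rightarrow> 'x::finite \<times> bool \<Rightarrow> 'x \<times> bool" and g +
  fixes t :: 'x and y0 :: 'y
  assumes f_t: "f b (t, s) = (t, s)" and g_t: "g b (t, s) = b"
    and moved: "n > 0 \<Longrightarrow> \<exists>w. reduced w \<and> t \<notin> fst ` set w \<and> (run (y0, True) ^^ n) w \<noteq> w"
begin

text \<open>The exponent sum in the letters \<open>b\<close>: every element shifts heights in the
  second tree by a constant, and the root has height 0.\<close>

definition height :: "nat \<Rightarrow> int" where
  "height x = hgt (dec (\<rho>2 x (wroot TYPE('y))) :: ('y \<times> bool) list)"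

definition a0 :: nat where "a0 = code [Inr (y0, True)]"
definition t0 :: nat where "t0 = code [Inl (t, True)]"

sublocale C: character_one G height a0
proof unfold_locales
  fix x y
  obtain c where c: "\<And>p. hgt (dec (\<rho>2 x p) :: ('y \<times> bool) list) = hgt (dec p :: ('y \<times> bool) list) + c"
    using hgt_\<rho>(2) by blast
  show "height (x \<otimes>\<^bsub>G\<^esub> y) = height x + height y"
    using c[of "\<rho>2 y (wroot TYPE('y))"] c[of "wroot TYPE('y)"] by (simp add: height_def \<rho>_mult)
next
  have "\<rho>2 a0 (wroot TYPE('y)) = enc [(y0, True)]"
    using act_own_root(2)[of "[(y0, True)]"] by (simp add: a0_def \<rho>_code)
  then show "height a0 = 1" by (simp add: height_def)
qed simp

lemma a0_pow: "a0 [^]\<^bsub>G\<^esub> n = code (replicate n (Inr (y0, True)))"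
proof (induction n)
  case (Suc n)
  then show ?case
    using mult_G[of "replicate n (Inr (y0, True))" "[Inr (y0, True)]"]
    by (simp add: a0_def replicate_append_same)
qed (simp add: one_G)

lemma reduced_run_pow: "reduced w \<Longrightarrow> reduced ((run b ^^ n) w)"
  by (induction n) (simp_all add: reduced_run)

lemma a0_pow_action:
  assumes "reduced w"
  shows "\<rho>1 (a0 [^]\<^bsub>G\<^esub> n) (enc w) = enc ((run (y0, True) ^^ n) w)"
  unfolding a0_pow \<rho>_code
  by (induction n) (simp_all add: gen1_def on_code_def reduced_run_pow assms)

text \<open>An element that fixes the first root has empty \<alpha> in its normal form, so it is a
  word in the letters \<open>b\<close>, all of which commute with \<open>t\<close>.\<close>

lemma t0_commutes:
  assumes "\<rho>1 x (wroot TYPE('x)) = wroot TYPE('x)"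
  shows "t0 \<otimes>\<^bsub>G\<^esub> x = x \<otimes>\<^bsub>G\<^esub> t0"
proof -
  obtain \<alpha> \<beta> where *: "reduced \<alpha>" "reduced \<beta>" "equiv_words (rep x) (map Inl \<alpha> @ map Inr \<beta>)"
    by (rule normal_form)
  then have x: "x = code (map Inl \<alpha> @ map Inr \<beta>)" by (metis code_eq_iff code_rep)
  then have "\<alpha> = []"
    using assms * enc_eq_root by (simp add: \<rho>_code act_root act_own_root)
  have "gen1 (Inl (t, True)) (gen1 (Inr b) p) = gen1 (Inr b) (gen1 (Inl (t, True)) p)"
    "gen2 (Inl (t, True)) (gen2 (Inr b) p) = gen2 (Inr b) (gen2 (Inl (t, True)) p)" for b p
    using square_relation[of b "(t, True)" p] by (simp_all add: f_t g_t)
  then have "gen1 (Inl (t, True)) (act1 (map Inr \<beta>) p) = act1 (map Inr \<beta>) (gen1 (Inl (t, True)) p)"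
    "gen2 (Inl (t, True)) (act2 (map Inr \<beta>) p) = act2 (map Inr \<beta>) (gen2 (Inl (t, True)) p)" for p
    by (induction \<beta>) simp_all
  then show ?thesis
    by (simp add: t0_def x \<open>\<alpha> = []\<close> mult_G code_eq_iff equiv_words_def)
qed

text \<open>The transducer preserves length and the alphabet is finite, so the orbit of a word under
  powers of \<open>a0\<close> is finite.\<close>

lemma a0_periodic: "\<exists>n>0. \<rho>1 (a0 [^]\<^bsub>G\<^esub> (n::nat)) p = p"
proof -
  let ?w = "dec p :: ('x \<times> bool) list"
  let ?F = "\<lambda>n::nat. \<rho>1 (a0 [^]\<^bsub>G\<^esub> n) p"
  have F: "?F n = enc ((run (y0, True) ^^ n) ?w)" for n
    using a0_pow_action[of ?w n] by simp
  have "length ((run (y0, True) ^^ n) ?w) = length ?w" for n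
    by (induction n) simp_all
  then have "range ?F \<subseteq> enc ` {w :: ('x \<times> bool) list. set w \<subseteq> UNIV \<and> length w = length ?w}"
    unfolding F by auto
  then have "finite (range ?F)"
    by (rule finite_subset) (intro finite_imageI finite_lists_length_eq finite)
  then have "\<not> inj ?F" using finite_imageD by blast
  then obtain i j where "i \<noteq> j" "?F i = ?F j" by (auto simp: inj_def)
  then obtain i j where ij: "i < j" "?F i = ?F j" by (cases i j rule: linorder_cases) auto
  have "a0 [^]\<^bsub>G\<^esub> j = a0 [^]\<^bsub>G\<^esub> i \<otimes>\<^bsub>G\<^esub> a0 [^]\<^bsub>G\<^esub> (j - i)"
    using ij(1) by (simp add: G.nat_pow_mult)
  then have "\<rho>1 (a0 [^]\<^bsub>G\<^esub> i) (?F (j - i)) = \<rho>1 (a0 [^]\<^bsub>G\<^esub> i) p"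
    using ij(2) by (simp add: \<rho>_mult)
  then have "?F (j - i) = p" by (metis \<rho>_inv(1))
  then show ?thesis using ij(1) by (intro exI[of _ "j - i"]) simp
qed

lemma conj_t0_commensurator: "x \<otimes>\<^bsub>G\<^esub> t0 \<otimes>\<^bsub>G\<^esub> inv\<^bsub>G\<^esub> x \<in> commensurator G C.H"
proof -
  let ?r = "wroot TYPE('x)"
  obtain n :: nat where n: "n > 0" "\<rho>1 (a0 [^]\<^bsub>G\<^esub> n) (\<rho>1 x ?r) = \<rho>1 x ?r"
    using a0_periodic by blast
  \<comment> \<open>The power was chosen to fix the vertex \<open>\<rho>1 x ?r\<close>, so
    \<open>?z\<close> fixes the root and \<open>t0_commutes\<close> applies.\<close>
  let ?z = "inv\<^bsub>G\<^esub> x \<otimes>\<^bsub>G\<^esub> a0 [^]\<^bsub>G\<^esub> n \<otimes>\<^bsub>G\<^esub> x"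
  have "t0 \<otimes>\<^bsub>G\<^esub> ?z = ?z \<otimes>\<^bsub>G\<^esub> t0"
    by (rule t0_commutes) (simp add: \<rho>_mult n(2) \<rho>_inv)
  then have "x \<otimes>\<^bsub>G\<^esub> (t0 \<otimes>\<^bsub>G\<^esub> ?z) \<otimes>\<^bsub>G\<^esub> inv\<^bsub>G\<^esub> x = x \<otimes>\<^bsub>G\<^esub> (?z \<otimes>\<^bsub>G\<^esub> t0) \<otimes>\<^bsub>G\<^esub> inv\<^bsub>G\<^esub> x"
    by simp
  moreover have "x \<otimes>\<^bsub>G\<^esub> (inv\<^bsub>G\<^esub> x \<otimes>\<^bsub>G\<^esub> y) = y" for y
    by (simp flip: G.m_assoc add: G.r_inv)
  ultimately have "x \<otimes>\<^bsub>G\<^esub> t0 \<otimes>\<^bsub>G\<^esub> inv\<^bsub>G\<^esub> x \<otimes>\<^bsub>G\<^esub> a0 [^]\<^bsub>G\<^esub> n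
      = a0 [^]\<^bsub>G\<^esub> n \<otimes>\<^bsub>G\<^esub> (x \<otimes>\<^bsub>G\<^esub> t0 \<otimes>\<^bsub>G\<^esub> inv\<^bsub>G\<^esub> x)"
    by (simp add: G.m_assoc G.r_inv)
  then show ?thesis using n(1) by (auto simp: C.commensurator_H)
qed

text \<open>Each \<open>f b\<close> is injective and fixes the letters \<open>(t, e)\<close>, so it
  turns no other letter into one of them; pushing introduces only the letter pushed.\<close>

lemma act_avoids_letter:
  assumes "\<And>s. s \<in> set u \<Longrightarrow> s \<notin> range (\<lambda>e. Inl (t, e))"
    and "t \<notin> fst ` set (dec p :: ('x \<times> bool) list)"
  shows "t \<notin> fst ` set (dec (act1 u p) :: ('x \<times> bool) list)"
  using assms(1)
proof (induction u)
  case (Cons s u)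
  then have IH: "t \<notin> fst ` set (dec (act1 u p) :: ('x \<times> bool) list)" by simp
  have push: "t \<notin> fst ` set (push a w)" if "fst a \<noteq> t" "t \<notin> fst ` set w" for a w
    using that by (cases w) auto
  have "f b a = f b (t, e) \<longleftrightarrow> a = (t, e)" for b a e by simp
  then have letter: "fst (f b a) = t \<Longrightarrow> fst a = t" for b a
    unfolding f_t by (metis fst_conv surj_pair)
  have run: "t \<notin> fst ` set (run b w)" if "t \<notin> fst ` set w" for b w
    using that
  proof (induction w arbitrary: b)
    case (Cons a w)
    then have "t \<notin> fst ` set (run (g b a) w)" "fst a \<noteq> t" by auto
    then show ?case using letter[of b a] by auto
  qed simp
  have "t \<notin> fst ` set (dec (gen1 s q) :: ('x \<times> bool) list)"
    if q: "t \<notin> fst ` set (dec q :: ('x \<times> bool) list)" for q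
  proof (cases s)
    case (Inl a)
    then have "fst a \<noteq> t" using Cons.prems[of s] by (cases a) auto
    then show ?thesis
      using push[OF _ q] by (simp add: Inl gen1_def on_code_def reduced_push)
  next
    case (Inr b)
    then show ?thesis using run[OF q] by (simp add: gen1_def on_code_def reduced_run)
  qed
  then show ?case using IH by simp
qed (use assms(2) in simp)

text \<open>If \<open>a0\<^sup>n\<close> commutes with \<open>x t0 x\<^sup>-\<^sup>1\<close>, where \<open>x\<close> is a word without \<open>t\<close>, then \<open>t0\<close> commutes
  with the \<open>a\<close>-part \<open>\<alpha>\<close> of the normal form of \<open>x\<^sup>-\<^sup>1 a0\<^sup>n x\<close>. This word does not contain \<open>t\<close>
  either, so it is empty.\<close>

lemma conj_t0_not_commutes:
  assumes "n > 0"
  shows "\<exists>y\<in>commensurator G C.H. y \<otimes>\<^bsub>G\<^esub> a0 [^]\<^bsub>G\<^esub> (n::nat) \<noteq> a0 [^]\<^bsub>G\<^esub> n \<otimes>\<^bsub>G\<^esub> y"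
proof (rule ccontr)
  let ?r = "wroot TYPE('x)"
  assume "\<not> ?thesis"
  then have comm: "y \<otimes>\<^bsub>G\<^esub> a0 [^]\<^bsub>G\<^esub> n = a0 [^]\<^bsub>G\<^esub> n \<otimes>\<^bsub>G\<^esub> y" if "y \<in> commensurator G C.H" for y
    using that by blast
  obtain w where w: "reduced w" "t \<notin> fst ` set w" "(run (y0, True) ^^ n) w \<noteq> w"
    using moved[OF assms] by blast
  define x where "x = code (map Inl w)"
  define z where "z = inv\<^bsub>G\<^esub> x \<otimes>\<^bsub>G\<^esub> a0 [^]\<^bsub>G\<^esub> n \<otimes>\<^bsub>G\<^esub> x"
  have cancel: "x \<otimes>\<^bsub>G\<^esub> (inv\<^bsub>G\<^esub> x \<otimes>\<^bsub>G\<^esub> y) = y" "inv\<^bsub>G\<^esub> x \<otimes>\<^bsub>G\<^esub> (x \<otimes>\<^bsub>G\<^esub> y) = y" for y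
    by (simp_all flip: G.m_assoc add: G.r_inv G.l_inv)
  \<comment> \<open>Conjugating the assumed commutation by \<open>x\<close> moves it to
    \<open>t0\<close> and \<open>z\<close>.\<close>
  have "inv\<^bsub>G\<^esub> x \<otimes>\<^bsub>G\<^esub> (x \<otimes>\<^bsub>G\<^esub> t0 \<otimes>\<^bsub>G\<^esub> inv\<^bsub>G\<^esub> x \<otimes>\<^bsub>G\<^esub> a0 [^]\<^bsub>G\<^esub> n) \<otimes>\<^bsub>G\<^esub> x
      = inv\<^bsub>G\<^esub> x \<otimes>\<^bsub>G\<^esub> (a0 [^]\<^bsub>G\<^esub> n \<otimes>\<^bsub>G\<^esub> (x \<otimes>\<^bsub>G\<^esub> t0 \<otimes>\<^bsub>G\<^esub> inv\<^bsub>G\<^esub> x)) \<otimes>\<^bsub>G\<^esub> x"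
    by (simp only: comm[OF conj_t0_commensurator])
  then have tz: "t0 \<otimes>\<^bsub>G\<^esub> z = z \<otimes>\<^bsub>G\<^esub> t0"
    by (simp add: z_def G.m_assoc cancel G.l_inv)
  define \<alpha> where "\<alpha> = (dec (\<rho>1 z ?r) :: ('x \<times> bool) list)"
  have z: "z = code (inverse_word (map Inl w) @ replicate n (Inr (y0, True)) @ map Inl w)"
    by (simp add: z_def x_def a0_pow inv_G mult_G)
  have "s \<notin> range (\<lambda>e. Inl (t, e))"
    if "s \<in> set (inverse_word (map Inl w) @ replicate n (Inr (y0, True)) @ map Inl w)" for s
    using that w(2) by (force simp: inverse_word_def neg_def)
  then have "t \<notin> fst ` set (dec (\<rho>1 z ?r) :: ('x \<times> bool) list)"
    unfolding z \<rho>_code by (rule act_avoids_letter) simp_all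
  then have \<alpha>: "t \<notin> fst ` set \<alpha>" by (simp only: \<alpha>_def not_False_eq_True)
  define a where "a = code (map Inl \<alpha>)"
  have a_root: "\<rho>1 a ?r = \<rho>1 z ?r"
    by (simp add: a_def \<rho>_code act_own_root(1) \<alpha>_def)
  \<comment> \<open>Both \<open>inv a z\<close> and \<open>z\<close> commute with \<open>t0\<close>,
    the former because it fixes the root; hence so does \<open>a\<close>.\<close>
  then have "\<rho>1 (inv\<^bsub>G\<^esub> a \<otimes>\<^bsub>G\<^esub> z) ?r = ?r" by (simp add: \<rho>_mult \<rho>_inv flip: a_root)
  then have "t0 \<otimes>\<^bsub>G\<^esub> (inv\<^bsub>G\<^esub> a \<otimes>\<^bsub>G\<^esub> z) = inv\<^bsub>G\<^esub> a \<otimes>\<^bsub>G\<^esub> z \<otimes>\<^bsub>G\<^esub> t0"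
    by (rule t0_commutes)
  also have "\<dots> = inv\<^bsub>G\<^esub> a \<otimes>\<^bsub>G\<^esub> t0 \<otimes>\<^bsub>G\<^esub> z" by (simp add: G.m_assoc tz)
  finally have "t0 \<otimes>\<^bsub>G\<^esub> inv\<^bsub>G\<^esub> a \<otimes>\<^bsub>G\<^esub> z = inv\<^bsub>G\<^esub> a \<otimes>\<^bsub>G\<^esub> t0 \<otimes>\<^bsub>G\<^esub> z" by (simp add: G.m_assoc)
  then have "t0 \<otimes>\<^bsub>G\<^esub> inv\<^bsub>G\<^esub> a = inv\<^bsub>G\<^esub> a \<otimes>\<^bsub>G\<^esub> t0" by (subst (asm) G.right_cancel) simp_all
  then have "a \<otimes>\<^bsub>G\<^esub> (t0 \<otimes>\<^bsub>G\<^esub> inv\<^bsub>G\<^esub> a) \<otimes>\<^bsub>G\<^esub> a = a \<otimes>\<^bsub>G\<^esub> (inv\<^bsub>G\<^esub> a \<otimes>\<^bsub>G\<^esub> t0) \<otimes>\<^bsub>G\<^esub> a" by simp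
  moreover have "a \<otimes>\<^bsub>G\<^esub> (inv\<^bsub>G\<^esub> a \<otimes>\<^bsub>G\<^esub> y) = y" for y
    by (simp flip: G.m_assoc add: G.r_inv)
  ultimately have "a \<otimes>\<^bsub>G\<^esub> t0 = t0 \<otimes>\<^bsub>G\<^esub> a" by (simp add: G.m_assoc G.l_inv)
  then have "\<rho>1 (a \<otimes>\<^bsub>G\<^esub> t0) ?r = \<rho>1 (t0 \<otimes>\<^bsub>G\<^esub> a) ?r" by simp
  then have "act1 (map Inl (\<alpha> @ [(t, True)])) ?r = act1 (map Inl ((t, True) # \<alpha>)) ?r"
    by (simp add: a_def t0_def mult_G \<rho>_code)
  moreover have "reduced \<alpha>" by (simp add: \<alpha>_def)
  then have red: "reduced (\<alpha> @ [(t, True)])" "reduced ((t, True) # \<alpha>)"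
    using \<alpha> by (auto simp: successively_append_iff successively_Cons neg_def image_iff prod_eq_iff)
      (metis fst_conv last_in_set, metis fst_conv hd_in_set)
  ultimately have "enc (\<alpha> @ [(t, True)]) = enc ((t, True) # \<alpha>)"
    by (simp only: act_own_root)
  then have "\<alpha> @ [(t, True)] = (t, True) # \<alpha>"
    using red by (metis dec_enc)
  then have "\<alpha> = []" using \<alpha> by (cases \<alpha>) auto
  \<comment> \<open>If \<open>z\<close> fixes the root, then \<open>a0^n\<close> fixes the vertex
    \<open>w\<close>, contrary to the choice of \<open>w\<close>.\<close>
  then have "\<rho>1 z ?r = ?r" by (metis \<alpha>_def enc_dec)
  then have "\<rho>1 x (\<rho>1 z ?r) = \<rho>1 x ?r" by simp
  then have "\<rho>1 (a0 [^]\<^bsub>G\<^esub> n) (\<rho>1 x ?r) = \<rho>1 x ?r"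
    by (simp add: z_def G.m_assoc cancel flip: \<rho>_mult)
  then have "enc ((run (y0, True) ^^ n) w) = enc w"
    using w(1) by (simp add: x_def \<rho>_code act_own_root a0_pow_action)
  then show False
    using w(1,3) reduced_run_pow by (metis dec_enc)
qed

end

section \<open>An affine bireversible automaton\<close>

text \<open>On positive letters the squares are \<open>b a = a' b'\<close> with \<open>a' = a + b\<close> and \<open>b' = b - a\<close> in
  \<open>\<int>/3\<close>; the other clauses are these squares read from their remaining corners.\<close>

fun af :: "3 \<times> bool \<Rightarrow> 3 option \<times> bool \<Rightarrow> 3 option \<times> bool" where
  "af b (None, r) = (None, r)"
| "af (b, True) (Some a, True) = (Some (a + b), True)"
| "af (b, False) (Some a, True) = (Some (a - b), True)"
| "af (b, s) (Some a, False) = (Some (b - a), False)"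

fun ag :: "3 \<times> bool \<Rightarrow> 3 option \<times> bool \<Rightarrow> 3 \<times> bool" where
  "ag b (None, r) = b"
| "ag (b, True) (Some a, True) = (b - a, True)"
| "ag (b, False) (Some a, True) = (- b - a, False)"
| "ag (b, True) (Some a, False) = (b + a, True)"
| "ag (b, False) (Some a, False) = (- b - a, False)"

lemma three_eq_0: "(3 :: 3) = 0"
  by simp

lemma mod3: "x + x + x = 0" for x :: 3
proof -
  have "x + x + x = 3 * x" by simp
  also have "\<dots> = 0" by (simp only: three_eq_0 mult_zero_left)
  finally show ?thesis .
qed

lemma squares_af_ag: "squares af ag"
proof
  fix b :: "3 \<times> bool" and a :: "3 option \<times> bool"
  obtain y s where b: "b = (y, s)" by (cases b)
  obtain x r where a: "a = (x, r)" by (cases a)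
  have "af (neg b) (af b a) = a \<and> ag (neg b) (af b a) = neg (ag b a) \<and>
    af (ag b a) (neg a) = neg (af b a) \<and> ag (ag b a) (neg a) = b \<and>
    snd (af b a) = snd a \<and> snd (ag b a) = snd b"
  proof (cases x)
    case None
    then show ?thesis unfolding a b by (simp add: neg_def)
  next
    case (Some z)
    show ?thesis
      unfolding a b Some using exhaust_3[of z] exhaust_3[of y]
      by (cases r; cases s; elim disjE; simp add: neg_def)
  qed
  then show "af (neg b) (af b a) = a" "ag (neg b) (af b a) = neg (ag b a)"
    "af (ag b a) (neg a) = neg (af b a)" "ag (ag b a) (neg a) = b"
    "snd (af b a) = snd a" "snd (ag b a) = snd b"
    by blast+
qed

text \<open>The transducer of \<open>af\<close> and \<open>ag\<close> on positive words, with signs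
  and \<open>Some\<close> stripped away.\<close>

fun shear :: "3 \<Rightarrow> 3 list \<Rightarrow> 3 list" where
  "shear b [] = []"
| "shear b (a # w) = (a + b) # shear (b - a) w"

lemma length_shear [simp]: "length (shear b w) = length w"
  by (induction w arbitrary: b) auto

abbreviation positive :: "3 list \<Rightarrow> (3 option \<times> bool) list" where
  "positive \<equiv> map (\<lambda>a. (Some a, True))"

lemma tr_positive: "tr af ag (b, True) (positive w) = positive (shear b w)"
  by (induction w arbitrary: b) auto

lemma reduced_positive: "reduced (positive w)"
  by (induction w) (auto simp: successively_Cons neg_def hd_map)

text \<open>In terms of generating functions, reading with state \<open>b\<close> is
  \<open>A \<mapsto> ((1 + X) A + b) / (1 - X)\<close>.\<close>

lemma shear_generating_function:
  "[:0, 1:] ^ length w dvd [:1, -1:] * Poly (shear b w) - [:1, 1:] * Poly w - [:b:]"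
proof (induction w arbitrary: b)
  case (Cons a w)
  let ?X = "[:0, 1:] :: 3 poly"
  let ?V = "Poly w" and ?V' = "Poly (shear (b - a) w)"
  have "?X ^ length w dvd [:1, -1:] * ?V' - [:1, 1:] * ?V - [:b - a:]" by (rule Cons.IH)
  then have "?X ^ length (a # w) dvd ?X * ([:1, -1:] * ?V' - [:1, 1:] * ?V - [:b - a:])"
    by (simp add: mult_dvd_mono del: mult_pCons_left mult_pCons_right)
  also have "?X * ([:1, -1:] * ?V' - [:1, 1:] * ?V - [:b - a:])
      = [:1, -1:] * Poly (shear b (a # w)) - [:1, 1:] * Poly (a # w) - [:b:]"
  proof -
    have one: "[:1, -1:] = 1 - ?X" "[:1, 1:] = 1 + ?X" by (simp_all add: one_pCons)
    have cons: "Poly (shear b (a # w)) = [:a + b:] + ?X * ?V'" "Poly (a # w) = [:a:] + ?X * ?V"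
      "[:b - a:] = [:b:] - [:a:]"
      by simp_all
    \<comment> \<open>The final summand is \<open>3 a X\<close>, which vanishes over the integers
      modulo 3.\<close>
    have "?X * ((1 - ?X) * ?V' - (1 + ?X) * ?V - ([:b:] - [:a:]))
        = (1 - ?X) * ([:a:] + [:b:] + ?X * ?V') - (1 + ?X) * ([:a:] + ?X * ?V) - [:b:]
          + ?X * ([:a:] + [:a:] + [:a:])"
      by (simp only: algebra_simps mult_1_left mult_1_right)
    also have "\<dots> = (1 - ?X) * ([:a + b:] + ?X * ?V') - (1 + ?X) * ([:a:] + ?X * ?V) - [:b:]"
      by (simp only: add_pCons mod3 pCons_0_0 mult_zero_right add_0_left add_0_right)
    finally show ?thesis
      by (simp only: one cons)
  qed
  finally show ?case .
qed simp

text \<open>For state 0 the constant drops out, so each run multiplies by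
  \<open>(1 + X) / (1 - X)\<close> modulo \<open>X ^ length w\<close>.\<close>

lemma shear_pow_generating_function:
  "[:0, 1:] ^ length w dvd [:1, -1:] ^ n * Poly ((shear 0 ^^ n) w) - [:1, 1:] ^ n * Poly w"
proof (induction n)
  case (Suc n)
  let ?W = "\<lambda>n. Poly ((shear 0 ^^ n) w)" and ?p = "[:1, -1:] :: 3 poly" and ?q = "[:1, 1:] :: 3 poly"
  have "length ((shear 0 ^^ n) w) = length w" by (induction n) simp_all
  then have "[:0, 1:] ^ length w dvd ?p * ?W (Suc n) - ?q * ?W n"
    using shear_generating_function[of "(shear 0 ^^ n) w" 0] by simp
  \<comment> \<open>The two congruences are weighted so that the terms with \<open>?W n\<close>
    telescope.\<close>
  then have "[:0, 1:] ^ length w dvd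
      ?p ^ n * (?p * ?W (Suc n) - ?q * ?W n) + ?q * (?p ^ n * ?W n - ?q ^ n * Poly w)"
    using Suc.IH by (intro dvd_add dvd_mult)
  also have "\<dots> = ?p ^ Suc n * ?W (Suc n) - ?q ^ Suc n * Poly w"
    by (simp only: power_Suc algebra_simps)
  finally show ?case .
qed simp

text \<open>A fixed word \<open>1 0 \<dots> 0\<close> would give \<open>(1 - X) ^ n = (1 + X) ^ n\<close>, which fails at \<open>X = 1\<close>.\<close>

lemma shear_moves:
  assumes "n > 0"
  shows "(shear 0 ^^ n) (1 # replicate n 0) \<noteq> 1 # replicate n 0"
proof
  let ?w = "1 # replicate n 0 :: 3 list"
  let ?D = "[:1, -1:] ^ n - [:1, 1:] ^ n :: 3 poly"
  assume fixed: "(shear 0 ^^ n) ?w = ?w"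
  have "Poly (replicate n 0) = (0 :: 3 poly)" by (induction n) simp_all
  then have "Poly ?w = 1" by (simp add: one_pCons)
  then have "[:0, 1:] ^ Suc n dvd ?D"
    using shear_pow_generating_function[of ?w n] fixed by simp
  then obtain r where r: "?D = monom 1 (Suc n) * r"
    by (auto simp: monom_altdef elim: dvdE)
  have deg: "degree ([:1, c:] ^ n) \<le> n" for c :: 3
    using degree_power_le[of "[:1, c:]" n] degree_pCons_le[of 1 "[:c:]"] by (simp split: if_splits)
  \<comment> \<open>The word has \<open>n + 1\<close> letters, one more than the degree bound
    \<open>n\<close>: divisibility by \<open>X ^ Suc n\<close> kills the coefficients up to
    \<open>n\<close>, and the degree kills the others.\<close>
  have "degree ?D \<le> n" by (intro degree_diff_le deg)
  then have "coeff ?D i = 0" if "i > n" for i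
    using that by (intro coeff_eq_0) simp
  moreover have "coeff ?D i = 0" if "i \<le> n" for i
    using that unfolding r by (simp add: coeff_monom_mult)
  ultimately have "?D = 0" by (intro poly_eqI) (metis coeff_0 not_le)
  then have "poly ?D 1 = 0" by simp
  then have "(2 :: 3) ^ n = 0" using assms by (simp add: zero_power)
  moreover have "(2 :: 3) * 2 = 1" by simp
  then have "(2 :: 3) ^ n * 2 ^ n = 1" by (metis power_mult_distrib power_one)
  ultimately show False by simp
qed

text \<open>Here \<open>None\<close> is the commuting letter \<open>t\<close> and
  \<open>(0, True)\<close> the state \<open>h\<close>. The moved words are positive, hence reduced
  and free of \<open>None\<close>.\<close>

interpretation affine: commuting_letter af ag None 0
proof -
  have "(tr af ag (0, True) ^^ n) (positive w) = positive ((shear 0 ^^ n) w)" for n w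
    by (induction n) (simp_all add: tr_positive)
  moreover have "inj positive" by (rule inj_mapI) (simp add: inj_def)
  ultimately have "(tr af ag (0, True) ^^ n) (positive (1 # replicate n 0)) \<noteq> positive (1 # replicate n 0)"
    if "n > 0" for n
    using shear_moves[OF that] by (simp only: inj_eq not_False_eq_True)
  moreover have "None \<notin> fst ` set (positive w)" for w by auto
  ultimately have "\<exists>w. reduced w \<and> None \<notin> fst ` set w \<and> (tr af ag (0, True) ^^ n) w \<noteq> w"
    if "n > 0" for n
    using that reduced_positive by blast
  then show "commuting_letter af ag None 0"
    by (intro commuting_letter.intro commuting_letter_axioms.intro square_group.intro squares_af_ag)
      auto
qed

theorem proposition9p1:
  shows "\<exists>(G :: nat monoid) (H :: nat set)
      (V1 :: nat set) (E1 :: (nat \<times> nat) set) (V2 :: nat set) (E2 :: (nat \<times> nat) set) \<phi>.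
    group G \<and> torsion_free G \<and>
    is_tree V1 E1 \<and> is_tree V2 E2 \<and>
    geometric_action G (realization V1 E1 \<times> realization V2 E2)
      (prod_dist (path_dist E1) (path_dist E2)) \<phi> \<and>
    subgroup H G \<and> G\<lparr>carrier := H\<rparr> \<cong> integer_group \<and>
    \<not> fin_gen_subgroup G (commensurator G H) \<and>
    (\<forall>K. subgroup K G \<and> K \<subseteq> H \<and> finite_index_in G K H \<longrightarrow>
       \<not> commensurator G H \<subseteq> normalizer G K)"
  using affine.G.is_group affine.torsion_free_G is_tree_wtree is_tree_wtree affine.geometric
    affine.C.subgroup_H affine.C.H_iso
    affine.C.not_fin_gen_commensurator[OF affine.conj_t0_not_commutes]
    affine.C.not_normalized[OF affine.conj_t0_not_commutes]
  by (intro exI conjI allI impI) (assumption | blast)+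

end
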